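(* Let $m_1,\ldots,m_k$ be positive integers generating a free abelian multiplicative subgroup of rank $k$ of $\mathbb{Q}\setminus\{0\}$, and let $$G=\langle q_1,\ldots,q_k,b_0\mid q_lb_0q_l^{-1}=b_0^{m_l},\ [q_l,q_j]=1,\ 1\le l,j\le k\rangle=B\rtimes Q,$$ with $Q=\langle q_1,\ldots,q_k\rangle$ and $B=\mathbb{Z}[m_1^{\pm1},\ldots,m_k^{\pm1}]$, where $q_l$ acts on $B$ by multiplication by $m_l$. Assume that each $m_l$ is coprime with $1-m_1$, and let $x=q_1$. Then $$\bar B:=B/(1-x)B=\mathbb{Z}[m_1^{\pm1},\ldots,m_k^{\pm1}]/(1-m_1)\mathbb{Z}[m_1^{\pm1},\ldots,m_k^{\pm1}]\cong\mathbb{Z}/(1-m_1)\mathbb{Z}.$$ Moreover, for elements $b,b_1\in B$ such that $bx$ and $b_1x$ are conjugate in $G$, finding the $Q$-component $y$ of an element conjugating $bx$ to $b_1x$ amounts to finding integers $t_2,\ldots,t_k$ such that $$m_2^{t_2}\cdots m_k^{t_k}\,\bar b=\bar b_1$$ in the ring of integers modulo $1-m_1$: for $y=q_1^{t_1}\cdots q_k^{t_k}$ there is $c\in B$ with $(cy)(bx)(cy)^{-1}=b_1x$ if and only if this congruence holds. In particular, for $k=2$ this is the problem of finding an integer $t_2$ with $m_2^{t_2}\bar b=\bar b_1$ in $\mathbb{Z}/(1-m_1)\mathbb{Z}$, an instance of the ordinary discrete logarithm problem.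
   Context: Here $B$ is written additively as a subring of $\mathbb{Q}$, with $b_0$ corresponding to $1\in\mathbb{Z}$. The bar denotes the class in $\bar B$; each $m_l$ is invertible modulo $1-m_1$, so negative exponents $t_l$ make sense there. "Instance of the ordinary discrete logarithm problem" means precisely: given $m_2$ and classes $\bar b,\bar b_1$ modulo $1-m_1$, find an exponent $t_2$ with $m_2^{t_2}\bar b=\bar b_1$. *)

theory Defs
  imports "HOL-Algebra.Algebra" "HOL-Algebra.Algebraic_Closure_Type"
begin

section \<open>Groups given by generators and relations\<close>

text \<open>A letter \<open>(x, True)\<close> stands for the generator \<open>x\<close> and \<open>(x, False)\<close> for its formal inverse.\<close>

type_synonym 'a letters = "('a \<times> bool) list"

definition letters_over :: "'a set \<Rightarrow> 'a letters set" where
  "letters_over S = lists (S \<times> UNIV)"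

text \<open>The least congruence on the words over \<open>S\<close> that contains the free cancellations and the
  relations \<open>r = s\<close> for \<open>(r, s) \<in> R\<close>.\<close>

inductive pres_cong :: "'a set \<Rightarrow> ('a letters \<times> 'a letters) set \<Rightarrow> 'a letters \<Rightarrow> 'a letters \<Rightarrow> bool"
  for S R where
  refl: "w \<in> letters_over S \<Longrightarrow> pres_cong S R w w"
| sym: "pres_cong S R v w \<Longrightarrow> pres_cong S R w v"
| trans: "pres_cong S R u v \<Longrightarrow> pres_cong S R v w \<Longrightarrow> pres_cong S R u w"
| cancel: "\<lbrakk>u \<in> letters_over S; v \<in> letters_over S; x \<in> S\<rbrakk>
    \<Longrightarrow> pres_cong S R (u @ [(x, e), (x, \<not> e)] @ v) (u @ v)"
| rel: "\<lbrakk>u \<in> letters_over S; v \<in> letters_over S; (r, s) \<in> R;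
      r \<in> letters_over S; s \<in> letters_over S\<rbrakk>
    \<Longrightarrow> pres_cong S R (u @ r @ v) (u @ s @ v)"

definition pres_class :: "'a set \<Rightarrow> ('a letters \<times> 'a letters) set \<Rightarrow> 'a letters \<Rightarrow> 'a letters set" where
  "pres_class S R w = {v. pres_cong S R w v}"

definition presented_group ::
    "'a set \<Rightarrow> ('a letters \<times> 'a letters) set \<Rightarrow> 'a letters set monoid" where
  "presented_group S R =
    \<lparr>carrier = pres_class S R ` letters_over S,
     monoid.mult = (\<lambda>A B. \<Union>a\<in>A. \<Union>b\<in>B. pres_class S R (a @ b)),
     one = pres_class S R []\<rparr>"

definition internal_semidirect :: "('a, 'b) monoid_scheme \<Rightarrow> 'a set \<Rightarrow> 'a set \<Rightarrow> bool" where
  "internal_semidirect G N H \<longleftrightarrow>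
     N \<lhd> G \<and> subgroup H G \<and> N \<inter> H = {\<one>\<^bsub>G\<^esub>} \<and> N <#>\<^bsub>G\<^esub> H = carrier G"


section \<open>The group \<open>G\<close>\<close>

datatype gen = Q nat | B0

definition gens :: "nat \<Rightarrow> gen set" where
  "gens k = insert B0 (Q ` {1..k})"

definition rels :: "nat \<Rightarrow> (nat \<Rightarrow> nat) \<Rightarrow> (gen letters \<times> gen letters) set" where
  "rels k m =
     {([(Q l, True), (B0, True), (Q l, False)], replicate (m l) (B0, True)) | l. l \<in> {1..k}} \<union>
     {([(Q l, True), (Q j, True), (Q l, False), (Q j, False)], []) | l j. l \<in> {1..k} \<and> j \<in> {1..k}}"

definition G :: "nat \<Rightarrow> (nat \<Rightarrow> nat) \<Rightarrow> gen letters set monoid" where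
  "G k m = presented_group (gens k) (rels k m)"

definition q :: "nat \<Rightarrow> (nat \<Rightarrow> nat) \<Rightarrow> nat \<Rightarrow> gen letters set" where
  "q k m l = pres_class (gens k) (rels k m) [(Q l, True)]"

definition b0 :: "nat \<Rightarrow> (nat \<Rightarrow> nat) \<Rightarrow> gen letters set" where
  "b0 k m = pres_class (gens k) (rels k m) [(B0, True)]"

definition Qgrp :: "nat \<Rightarrow> (nat \<Rightarrow> nat) \<Rightarrow> gen letters set set" where
  "Qgrp k m = generate (G k m) (q k m ` {1..k})"

text \<open>The product of the powers \<open>(q l)^(t l)\<close> for \<open>l = 1, \<dots>, k\<close>, in this order.\<close>

definition qpow :: "nat \<Rightarrow> (nat \<Rightarrow> nat) \<Rightarrow> (nat \<Rightarrow> int) \<Rightarrow> gen letters set" where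
  "qpow k m t =
     foldr (\<lambda>l y. (q k m l [^]\<^bsub>G k m\<^esub> t l) \<otimes>\<^bsub>G k m\<^esub> y) [1..<Suc k] \<one>\<^bsub>G k m\<^esub>"


section \<open>The ring \<open>B\<close> and its quotient by \<open>(1 - x)B\<close>\<close>

abbreviation rat_ring :: "rat ring" where
  "rat_ring \<equiv> ring_of_type_algebra"

definition Bring :: "nat \<Rightarrow> (nat \<Rightarrow> nat) \<Rightarrow> rat ring" where
  "Bring k m = rat_ring\<lparr>carrier := generate_ring rat_ring
     ((\<lambda>l. of_nat (m l)) ` {1..k} \<union> (\<lambda>l. inverse (of_nat (m l))) ` {1..k})\<rparr>"

text \<open>\<open>q\<^sub>l\<close> acts on \<open>B\<close> by multiplication by \<open>m\<^sub>l\<close>, and \<open>x = q\<^sub>1\<close>.\<close>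

definition act :: "(nat \<Rightarrow> nat) \<Rightarrow> nat \<Rightarrow> rat \<Rightarrow> rat" where
  "act m l b = of_nat (m l) * b"

definition one_minus_x_B :: "nat \<Rightarrow> (nat \<Rightarrow> nat) \<Rightarrow> rat set" where
  "one_minus_x_B k m = (\<lambda>b. b - act m 1 b) ` carrier (Bring k m)"

definition Bbar :: "nat \<Rightarrow> (nat \<Rightarrow> nat) \<Rightarrow> rat set ring" where
  "Bbar k m = Bring k m Quot one_minus_x_B k m"

definition bar :: "nat \<Rightarrow> (nat \<Rightarrow> nat) \<Rightarrow> rat \<Rightarrow> rat set" where
  "bar k m b = one_minus_x_B k m +>\<^bsub>Bring k m\<^esub> b"

text \<open>\<open>\<beta>\<close> exhibits \<open>G\<close> as \<open>B \<rtimes> Q\<close>: it embeds the additive group of \<open>B\<close> into \<open>G\<close>.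
  These conditions determine \<open>\<beta>\<close> uniquely.\<close>

definition semidirect_identification ::
    "nat \<Rightarrow> (nat \<Rightarrow> nat) \<Rightarrow> (rat \<Rightarrow> gen letters set) \<Rightarrow> bool" where
  "semidirect_identification k m \<beta> \<longleftrightarrow>
     \<beta> \<in> mon (add_monoid (Bring k m)) (G k m) \<and>
     \<beta> 1 = b0 k m \<and>
     (\<forall>l\<in>{1..k}. \<forall>b\<in>carrier (Bring k m).
        q k m l \<otimes>\<^bsub>G k m\<^esub> \<beta> b \<otimes>\<^bsub>G k m\<^esub> inv\<^bsub>G k m\<^esub> (q k m l) = \<beta> (act m l b)) \<and>
     internal_semidirect (G k m) (\<beta> ` carrier (Bring k m)) (Qgrp k m)"


section \<open>Conjugacy and discrete logarithms\<close>

definition conjugates :: "('a, 'b) monoid_scheme \<Rightarrow> 'a \<Rightarrow> 'a \<Rightarrow> 'a \<Rightarrow> bool" where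
  "conjugates H g u v \<longleftrightarrow> g \<otimes>\<^bsub>H\<^esub> u \<otimes>\<^bsub>H\<^esub> inv\<^bsub>H\<^esub> g = v"

text \<open>The \<open>Q\<close>-components \<open>y\<close> of the elements \<open>cy\<close>, \<open>c \<in> B\<close>, conjugating \<open>bx\<close> to \<open>b\<^sub>1x\<close>.\<close>

definition conjugator_Q_components ::
    "nat \<Rightarrow> (nat \<Rightarrow> nat) \<Rightarrow> (rat \<Rightarrow> gen letters set) \<Rightarrow> rat \<Rightarrow> rat \<Rightarrow> gen letters set set" where
  "conjugator_Q_components k m \<beta> b b1 =
     {y \<in> Qgrp k m. \<exists>c\<in>carrier (Bring k m).
        conjugates (G k m) (\<beta> c \<otimes>\<^bsub>G k m\<^esub> y)
          (\<beta> b \<otimes>\<^bsub>G k m\<^esub> q k m 1) (\<beta> b1 \<otimes>\<^bsub>G k m\<^esub> q k m 1)}"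

text \<open>\<open>t\<close> solves the discrete logarithm problem \<open>g\<^sup>t a = a'\<close> in \<open>R\<close>; meant for a unit \<open>g\<close>, for
  which the power with an integer exponent uses the inverse of \<open>g\<close> in \<open>R\<close>.\<close>

definition is_dlog :: "('a, 'b) ring_scheme \<Rightarrow> 'a \<Rightarrow> 'a \<Rightarrow> 'a \<Rightarrow> int \<Rightarrow> bool" where
  "is_dlog R g a a' t \<longleftrightarrow> (g [^]\<^bsub>R\<^esub> t) \<otimes>\<^bsub>R\<^esub> a = a'"

end

theory Submission
  imports Defs
begin

text \<open>Let \<open>M\<close> be the product of the \<open>m\<^sub>l\<close>, so that \<open>B = \<int>[1/M]\<close>.

  The quotient. As \<open>M\<close> is coprime to \<open>1 - m\<^sub>1\<close>, every fraction with a power of \<open>M\<close> as denominator is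
  congruent to an integer modulo \<open>(1 - m\<^sub>1)B\<close> (\<open>bar_eq_bar_of_int\<close>), and an integer lies in
  \<open>(1 - m\<^sub>1)B\<close> only if it is divisible by \<open>1 - m\<^sub>1\<close> (\<open>of_int_mem_I_iff\<close>). So the map from \<open>\<int>\<close> to the
  quotient is surjective with the expected kernel.

  The group. Let \<open>u\<close> be the product of the \<open>q\<^sub>l\<close>. Then \<open>u b\<^sub>0 u\<^sup>-\<^sup>1 = b\<^sub>0\<^sup>M\<close>, so the element
  \<open>u\<^sup>-\<^sup>n b\<^sub>0\<^sup>a u\<^sup>n\<close> depends only on the fraction \<open>a / M\<^sup>n\<close>, and this defines an additive map from \<open>B\<close> to
  \<open>G\<close> (\<open>rat_power_add\<close>) on which \<open>q\<^sub>l\<close> acts as multiplication by \<open>m\<^sub>l\<close>. That its image and \<open>Q\<close> span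
  \<open>G\<close> follows by collecting the letters of a word (\<open>G_decomposition\<close>). That nothing collapses is
  seen in the action of \<open>G\<close> on \<open>\<rat>\<close> by affine maps (\<open>affine_action\<close>): elements of \<open>B\<close> are
  translations, whereas elements of \<open>Q\<close> fix \<open>0\<close>.

  Conjugacy. Let \<open>s = m\<^sub>1\<^bsup>t\<^sub>1\<^esup> \<dots> m\<^sub>k\<^bsup>t\<^sub>k\<^esup>\<close> be the factor by which \<open>y\<close> acts. In \<open>G\<close>, written with \<open>B\<close>
  additive, \<open>(cy)(bx) = (c + sb)yx\<close> and \<open>(b\<^sub>1x)(cy) = (b\<^sub>1 + m\<^sub>1c)xy\<close>. So \<open>cy\<close> conjugates \<open>bx\<close> to
  \<open>b\<^sub>1x\<close> if and only if \<open>sb - b\<^sub>1 = -(1 - m\<^sub>1)c\<close> (\<open>conjugates_iff\<close>), and a suitable \<open>c\<close> exists if and only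
  if \<open>sb\<close> and \<open>b\<^sub>1\<close> have the same class. Modulo \<open>1 - m\<^sub>1\<close> the factor \<open>m\<^sub>1\<close> is \<open>1\<close>, which removes \<open>t\<^sub>1\<close>
  from the congruence (\<open>\<phi>_scale\<close>).\<close>


section \<open>Groups given by a presentation\<close>

lemma letters_over_simps [simp]:
  "[] \<in> letters_over S"
  "p # w \<in> letters_over S \<longleftrightarrow> fst p \<in> S \<and> w \<in> letters_over S"
  "v @ w \<in> letters_over S \<longleftrightarrow> v \<in> letters_over S \<and> w \<in> letters_over S"
  "replicate n p \<in> letters_over S \<longleftrightarrow> n = 0 \<or> fst p \<in> S"
  by (cases p; force simp: letters_over_def in_lists_conv_set)+

lemma pres_cong_letters_over:
  "pres_cong S R v w \<Longrightarrow> v \<in> letters_over S \<and> w \<in> letters_over S"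
  by (induction rule: pres_cong.induct) auto

lemma pres_cong_append_both:
  assumes "pres_cong S R v w" "a \<in> letters_over S" "b \<in> letters_over S"
  shows "pres_cong S R (a @ v @ b) (a @ w @ b)"
  using assms
proof (induction rule: pres_cong.induct)
  case (refl w)
  then show ?case by (auto intro: pres_cong.refl)
next
  case (sym v w)
  then show ?case by (auto intro: pres_cong.sym)
next
  case (trans u v w)
  then show ?case by (blast intro: pres_cong.trans)
next
  case (cancel u v x e)
  then show ?case using pres_cong.cancel[of "a @ u" S "v @ b" x R e] by simp
next
  case (rel u v r s)
  then show ?case using pres_cong.rel[of "a @ u" S "v @ b" r s R] by simp
qed

lemma pres_cong_append:
  assumes "pres_cong S R v v'" "pres_cong S R w w'"
  shows "pres_cong S R (v @ w) (v' @ w')"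
proof -
  have "pres_cong S R ([] @ v @ w) ([] @ v' @ w)"
    using assms pres_cong_letters_over by (intro pres_cong_append_both) auto
  moreover have "pres_cong S R (v' @ w @ []) (v' @ w' @ [])"
    using assms pres_cong_letters_over by (intro pres_cong_append_both) auto
  ultimately show ?thesis by (auto intro: pres_cong.trans)
qed

lemma pres_class_eqI: "pres_cong S R v w \<Longrightarrow> pres_class S R v = pres_class S R w"
  by (auto simp: pres_class_def intro: pres_cong.trans pres_cong.sym)

lemma pres_class_self: "w \<in> letters_over S \<Longrightarrow> w \<in> pres_class S R w"
  by (simp add: pres_class_def pres_cong.refl)

text \<open>The product of two classes is defined as a union over representatives; since the relation is a
  congruence, all the classes in this union coincide.\<close>

lemma presented_mult:
  assumes "v \<in> letters_over S" "w \<in> letters_over S"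
  shows "pres_class S R v \<otimes>\<^bsub>presented_group S R\<^esub> pres_class S R w = pres_class S R (v @ w)"
proof -
  have "pres_class S R (a @ b) = pres_class S R (v @ w)"
    if "a \<in> pres_class S R v" "b \<in> pres_class S R w" for a b
  proof (rule pres_class_eqI[symmetric])
    show "pres_cong S R (v @ w) (a @ b)"
      using that by (auto simp: pres_class_def intro: pres_cong_append)
  qed
  then have "(\<Union>a\<in>pres_class S R v. \<Union>b\<in>pres_class S R w. pres_class S R (a @ b))
      = (\<Union>a\<in>pres_class S R v. \<Union>b\<in>pres_class S R w. pres_class S R (v @ w))"
    by (auto intro!: SUP_cong)
  also have "\<dots> = pres_class S R (v @ w)"
    using pres_class_self[OF assms(1)] pres_class_self[OF assms(2)] by (metis SUP_const empty_iff)
  finally have "(\<Union>a\<in>pres_class S R v. \<Union>b\<in>pres_class S R w. pres_class S R (a @ b))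
      = pres_class S R (v @ w)" .
  then show ?thesis by (simp add: presented_group_def)
qed

lemma presented_one: "\<one>\<^bsub>presented_group S R\<^esub> = pres_class S R []"
  by (simp add: presented_group_def)

lemma presented_carrier: "carrier (presented_group S R) = pres_class S R ` letters_over S"
  by (simp add: presented_group_def)

lemma presented_cancel:
  "x \<in> S \<Longrightarrow> pres_class S R [(x, e), (x, \<not> e)] = pres_class S R []"
  using pres_cong.cancel[of "[]" S "[]" x R e] by (simp add: pres_class_eqI)

lemma presented_rel:
  "\<lbrakk>(r, s) \<in> R; r \<in> letters_over S; s \<in> letters_over S\<rbrakk>
    \<Longrightarrow> pres_class S R r = pres_class S R s"
  using pres_cong.rel[of "[]" S "[]" r s R] by (simp add: pres_class_eqI)

lemma group_presented_group: "group (presented_group S R)"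
proof (rule groupI)
  fix x assume "x \<in> carrier (presented_group S R)"
  then obtain w where w: "w \<in> letters_over S" "x = pres_class S R w"
    by (auto simp: presented_carrier)
  have "\<exists>v \<in> letters_over S. pres_class S R (v @ w) = pres_class S R []"
    using w(1)
  proof (induction w)
    case (Cons p w)
    obtain y e where p: "p = (y, e)" by (cases p)
    with Cons obtain v where v: "v \<in> letters_over S" "pres_class S R (v @ w) = pres_class S R []"
      by auto
    have "pres_cong S R ((v @ [(y, \<not> e)]) @ p # w) (v @ w)"
      using pres_cong.cancel[of v S w y R "\<not> e"] v Cons.prems p by simp
    then have "pres_class S R ((v @ [(y, \<not> e)]) @ p # w) = pres_class S R []"
      using v by (metis pres_class_eqI)
    then show ?case
      using v Cons.prems p by (intro bexI[of _ "v @ [(y, \<not> e)]"]) auto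
  qed (auto intro: bexI[of _ "[]"])
  then show "\<exists>y\<in>carrier (presented_group S R). y \<otimes>\<^bsub>presented_group S R\<^esub> x = \<one>\<^bsub>presented_group S R\<^esub>"
    using w by (auto simp: presented_carrier presented_mult presented_one)
qed (auto simp: presented_carrier presented_mult presented_one)

lemma presented_letter_inv:
  assumes "x \<in> S"
  shows "pres_class S R [(x, False)] = inv\<^bsub>presented_group S R\<^esub> pres_class S R [(x, True)]"
proof -
  interpret group "presented_group S R" by (rule group_presented_group)
  show ?thesis
    using assms presented_cancel[OF assms, of R False]
    by (subst inv_equality) (auto simp: presented_carrier presented_mult presented_one)
qed

text \<open>The value in \<open>H\<close> of a word whose generators are sent to \<open>H\<close> by \<open>f\<close>.\<close>

definition word_value :: "('b, 'c) monoid_scheme \<Rightarrow> ('a \<Rightarrow> 'b) \<Rightarrow> 'a letters \<Rightarrow> 'b" where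
  "word_value H f w =
     foldr (\<lambda>(x, e) y. (if e then f x else inv\<^bsub>H\<^esub> f x) \<otimes>\<^bsub>H\<^esub> y) w \<one>\<^bsub>H\<^esub>"

lemma word_value_Nil [simp]: "word_value H f [] = \<one>\<^bsub>H\<^esub>"
  by (simp add: word_value_def)

lemma word_value_Cons [simp]: "word_value H f ((x, e) # w) =
    (if e then f x else inv\<^bsub>H\<^esub> f x) \<otimes>\<^bsub>H\<^esub> word_value H f w"
  by (simp add: word_value_def)

context group
begin

lemma word_value_closed:
  "\<lbrakk>f \<in> S \<rightarrow> carrier G; w \<in> letters_over S\<rbrakk> \<Longrightarrow> word_value G f w \<in> carrier G"
  by (induction w) (auto simp: Pi_iff)

lemma word_value_append:
  "\<lbrakk>f \<in> S \<rightarrow> carrier G; v \<in> letters_over S; w \<in> letters_over S\<rbrakk>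
    \<Longrightarrow> word_value G f (v @ w) = word_value G f v \<otimes> word_value G f w"
proof (induction v)
  case Nil
  then show ?case using word_value_closed[of f S w] by simp
next
  case (Cons p v)
  then show ?case
    using word_value_closed[of f S v] word_value_closed[of f S w]
    by (cases p) (auto simp: m_assoc Pi_iff)
qed

lemma word_value_pres_cong:
  assumes f: "f \<in> S \<rightarrow> carrier G"
    and R: "\<And>r s. \<lbrakk>(r, s) \<in> R; r \<in> letters_over S; s \<in> letters_over S\<rbrakk>
      \<Longrightarrow> word_value G f r = word_value G f s"
    and "pres_cong S R v w"
  shows "word_value G f v = word_value G f w"
  using assms(3)
proof (induction rule: pres_cong.induct)
  case (cancel u v x e)
  have "f x \<in> carrier G" using f cancel by auto
  then have "word_value G f ([(x, e), (x, \<not> e)] @ v) = word_value G f v"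
    using word_value_closed[OF f cancel(2)] by (cases e) (auto simp flip: m_assoc)
  then show ?case
    using cancel by (simp add: word_value_append[OF f] del: append_Cons)
next
  case (rel u v r s)
  then show ?case by (simp add: word_value_append[OF f] R)
qed simp_all

text \<open>Von Dyck's theorem: a map of the generators under which the relations hold in a group
  extends to the presented group.\<close>

lemma presented_group_lift:
  assumes f: "f \<in> S \<rightarrow> carrier G"
    and R: "\<And>r s. \<lbrakk>(r, s) \<in> R; r \<in> letters_over S; s \<in> letters_over S\<rbrakk>
      \<Longrightarrow> word_value G f r = word_value G f s"
  obtains h where "h \<in> hom (presented_group S R) G"
    and "\<And>x. x \<in> S \<Longrightarrow> h (pres_class S R [(x, True)]) = f x"
proof
  let ?h = "\<lambda>A. word_value G f (SOME w. w \<in> A)"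
  have h: "?h (pres_class S R w) = word_value G f w" if "w \<in> letters_over S" for w
  proof -
    have "(SOME v. v \<in> pres_class S R w) \<in> pres_class S R w"
      using pres_class_self[OF that] by (rule someI)
    then show ?thesis
      using word_value_pres_cong[OF f R] unfolding pres_class_def by force
  qed
  show "?h \<in> hom (presented_group S R) G"
    by (rule homI)
      (auto simp: presented_carrier presented_mult h word_value_append[OF f]
        intro: word_value_closed[OF f])
  show "?h (pres_class S R [(x, True)]) = f x" if "x \<in> S" for x
    using that f by (auto simp: h Pi_iff)
qed

end

text \<open>The letters generate the presented group, as a monoid.\<close>

lemma presented_group_induct [consumes 1, case_names one letter]:
  assumes "g \<in> carrier (presented_group S R)"
    and "P \<one>\<^bsub>presented_group S R\<^esub>"
    and "\<And>x e h. \<lbrakk>x \<in> S; h \<in> carrier (presented_group S R); P h\<rbrakk>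
      \<Longrightarrow> P (pres_class S R [(x, e)] \<otimes>\<^bsub>presented_group S R\<^esub> h)"
  shows "P g"
proof -
  obtain w where w: "w \<in> letters_over S" "g = pres_class S R w"
    using assms(1) by (auto simp: presented_carrier)
  have "P (pres_class S R w)" using w(1)
  proof (induction w)
    case Nil
    then show ?case using assms(2) by (simp add: presented_one)
  next
    case (Cons p w)
    then show ?case
      using assms(3)[of "fst p" "pres_class S R w" "snd p"]
      by (simp add: presented_mult presented_carrier)
  qed
  with w show ?thesis by simp
qed


section \<open>Conjugation and commuting powers\<close>

context group
begin

lemma conj_hom: "x \<in> carrier G \<Longrightarrow> (\<lambda>y. x \<otimes> y \<otimes> inv x) \<in> hom G G"
  by (rule homI) (simp_all add: m_assoc inv_solve_left', simp flip: m_assoc)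

lemma conj_int_pow:
  assumes "x \<in> carrier G" "y \<in> carrier G"
  shows "x \<otimes> (y [^] (a::int)) \<otimes> inv x = (x \<otimes> y \<otimes> inv x) [^] a"
  using hom_int_pow[OF conj_hom[OF assms(1)] assms(2) is_group] by simp

lemma conj_eq_iff_commute:
  "\<lbrakk>x \<in> carrier G; y \<in> carrier G; z \<in> carrier G\<rbrakk>
    \<Longrightarrow> x \<otimes> y \<otimes> inv x = z \<longleftrightarrow> x \<otimes> y = z \<otimes> x"
  by (metis inv_solve_right' m_closed)

lemma int_pow_commute:
  assumes "x \<in> carrier G" "y \<in> carrier G" "x \<otimes> y = y \<otimes> x"
  shows "x \<otimes> (y [^] (a::int)) = (y [^] a) \<otimes> x"
  using conj_int_pow[OF assms(1,2), of a] assms conj_eq_iff_commute[of x y y]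
    conj_eq_iff_commute[of x "y [^] a" "y [^] a"] by simp

end


section \<open>Products of powers of commuting elements\<close>

definition power_product ::
    "('a, 'c) monoid_scheme \<Rightarrow> ('b \<Rightarrow> 'a) \<Rightarrow> ('b \<Rightarrow> int) \<Rightarrow> 'b list \<Rightarrow> 'a" where
  "power_product H x t ls = foldr (\<lambda>l y. (x l [^]\<^bsub>H\<^esub> t l) \<otimes>\<^bsub>H\<^esub> y) ls \<one>\<^bsub>H\<^esub>"

context group
begin

lemma power_product_simps [simp]:
  "power_product G x t [] = \<one>"
  "power_product G x t (l # ls) = (x l [^] t l) \<otimes> power_product G x t ls"
  by (simp_all add: power_product_def)

lemma power_product_closed:
  "x ` set ls \<subseteq> carrier G \<Longrightarrow> power_product G x t ls \<in> carrier G"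
  by (induction ls) auto

lemma power_product_commute:
  assumes "x ` set ls \<subseteq> carrier G" "y \<in> carrier G" "\<And>l. l \<in> set ls \<Longrightarrow> y \<otimes> x l = x l \<otimes> y"
  shows "y \<otimes> power_product G x t ls = power_product G x t ls \<otimes> y"
  using assms
proof (induction ls)
  case (Cons l ls)
  have xl: "x l [^] t l \<in> carrier G" and p: "power_product G x t ls \<in> carrier G"
    using Cons.prems by (auto intro: power_product_closed)
  have "y \<otimes> (x l [^] t l \<otimes> power_product G x t ls) = (y \<otimes> x l [^] t l) \<otimes> power_product G x t ls"
    using Cons.prems xl p by (simp add: m_assoc)
  also have "y \<otimes> x l [^] t l = x l [^] t l \<otimes> y"
    using Cons.prems by (intro int_pow_commute) auto
  also have "x l [^] t l \<otimes> y \<otimes> power_product G x t ls = x l [^] t l \<otimes> (y \<otimes> power_product G x t ls)"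
    using Cons.prems xl p by (simp add: m_assoc)
  also have "\<dots> = (x l [^] t l \<otimes> power_product G x t ls) \<otimes> y"
    using Cons xl p by (simp add: m_assoc)
  finally show ?case by simp
qed auto

lemma power_product_add:
  assumes "x ` set ls \<subseteq> carrier G"
    and "\<And>l j. \<lbrakk>l \<in> set ls; j \<in> set ls\<rbrakk> \<Longrightarrow> x l \<otimes> x j = x j \<otimes> x l"
  shows "power_product G x (\<lambda>l. s l + t l) ls = power_product G x s ls \<otimes> power_product G x t ls"
  using assms
proof (induction ls)
  case (Cons l ls)
  let ?s = "power_product G x s ls" and ?t = "power_product G x t ls"
  have [simp]: "x l \<in> carrier G" "?s \<in> carrier G" "?t \<in> carrier G"
    using Cons.prems by (auto intro: power_product_closed)
  have "?s \<otimes> x l [^] t l = x l [^] t l \<otimes> ?s"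
    using Cons.prems power_product_commute[of x ls "x l" s] by (intro int_pow_commute) auto
  then have "(x l [^] s l \<otimes> ?s) \<otimes> (x l [^] t l \<otimes> ?t) = x l [^] s l \<otimes> (x l [^] t l \<otimes> ?s) \<otimes> ?t"
    by (simp add: m_assoc flip: m_assoc[of ?s])
  then show ?case
    using Cons by (simp add: int_pow_mult m_assoc)
qed auto

lemma power_product_single:
  assumes "x ` set ls \<subseteq> carrier G" "distinct ls" "l \<in> set ls"
  shows "power_product G x (\<lambda>j. if j = l then 1 else 0) ls = x l"
proof -
  have "power_product G x (\<lambda>j. if j = l then 1 else 0) ls = (if l \<in> set ls then x l else \<one>)"
    using assms(1,2) by (induction ls) auto
  then show ?thesis using assms(3) by simp
qed

end


section \<open>Fractions whose denominator is a power of a fixed integer\<close>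

text \<open>The ring \<open>\<int>[1/M]\<close>. Inverting the product \<open>M\<close> of the \<open>m\<^sub>l\<close> inverts each of them, so \<open>B\<close> is of
  this form and each of its elements is a fraction described by a single exponent.\<close>

definition power_fractions :: "nat \<Rightarrow> rat set" where
  "power_fractions M = {of_int a / of_nat M ^ n | a n. True}"

lemma power_fractionsI [intro]: "of_int a / of_nat M ^ n \<in> power_fractions M"
  by (auto simp: power_fractions_def)

lemma power_fractions_common_denominator:
  assumes "0 < M" "r \<in> power_fractions M" "s \<in> power_fractions M"
  obtains a c n where "r = of_int a / of_nat M ^ n" "s = of_int c / of_nat M ^ n"
proof -
  obtain a i c j where "r = of_int a / of_nat M ^ i" "s = of_int c / of_nat M ^ j"
    using assms by (auto simp: power_fractions_def)
  then have "r = of_int (a * int M ^ j) / of_nat M ^ (i + j)"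
    "s = of_int (c * int M ^ i) / of_nat M ^ (i + j)"
    using assms(1) by (simp_all add: power_add)
  then show ?thesis by (rule that)
qed

lemma of_int_power_fractions [simp]: "of_int a \<in> power_fractions M"
  using power_fractionsI[of a M 0] by simp

lemma of_nat_power_fractions [simp]: "of_nat a \<in> power_fractions M"
  using of_int_power_fractions[of "int a" M] by simp

lemma one_power_fractions [simp]: "1 \<in> power_fractions M"
  and zero_power_fractions [simp]: "0 \<in> power_fractions M"
  using of_int_power_fractions[of 1 M] of_int_power_fractions[of 0 M] by simp_all

lemma power_fractions_add:
  assumes "0 < M" "r \<in> power_fractions M" "s \<in> power_fractions M"
  shows "r + s \<in> power_fractions M"
proof -
  obtain a c n where "r = of_int a / of_nat M ^ n" "s = of_int c / of_nat M ^ n"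
    using power_fractions_common_denominator[OF assms] .
  then have "r + s = of_int (a + c) / of_nat M ^ n" by (simp add: add_divide_distrib)
  then show ?thesis by (simp only: power_fractionsI)
qed

lemma power_fractions_mult:
  assumes "r \<in> power_fractions M" "s \<in> power_fractions M"
  shows "r * s \<in> power_fractions M"
proof -
  obtain a i c j where "r = of_int a / of_nat M ^ i" "s = of_int c / of_nat M ^ j"
    using assms by (auto simp: power_fractions_def)
  then have "r * s = of_int (a * c) / of_nat M ^ (i + j)" by (simp add: power_add)
  then show ?thesis by (simp only: power_fractionsI)
qed

lemma power_fractions_uminus: "r \<in> power_fractions M \<Longrightarrow> - r \<in> power_fractions M"
  using power_fractions_mult[OF of_int_power_fractions[of "-1"], of r M] by simp

lemma power_fractions_diff:
  "\<lbrakk>0 < M; r \<in> power_fractions M; s \<in> power_fractions M\<rbrakk> \<Longrightarrow> r - s \<in> power_fractions M"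
  using power_fractions_add[of M r "- s"] power_fractions_uminus[of s M] by simp

lemma power_fractions_inverse_dvd:
  assumes "0 < M" "d dvd M"
  shows "inverse (of_nat d) \<in> power_fractions M"
proof -
  obtain e where "M = d * e" using assms(2) by auto
  then have "inverse (of_nat d) = (of_int (int e) / of_nat M ^ 1 :: rat)"
    using assms(1) by (simp add: field_simps)
  then show ?thesis by (metis power_fractionsI)
qed

lemma power_fractions_powi:
  assumes "0 < M" "d dvd M"
  shows "of_nat d powi a \<in> power_fractions M"
proof -
  have "r ^ n \<in> power_fractions M" if "r \<in> power_fractions M" for r and n :: nat
    using that by (induction n) (auto intro: power_fractions_mult)
  then show ?thesis
    using power_fractions_inverse_dvd[OF assms] by (simp add: power_int_def)
qed


section \<open>Roots of an element that a conjugation raises to a power\<close>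

text \<open>If \<open>u b u\<^sup>-\<^sup>1 = b\<^sup>M\<close>, then \<open>u\<^sup>-\<^sup>n b u\<^sup>n\<close> is an \<open>M\<^sup>n\<close>-th root of \<open>b\<close>, and each of these roots is a
  power of the next. So the powers \<open>b\<^sup>r\<close> make sense for all \<open>r\<close> in \<open>\<int>[1/M]\<close>. This constructs the
  map from \<open>B\<close> to \<open>G\<close>, where \<open>M\<close> is the product of the \<open>m\<^sub>l\<close> and \<open>u\<close> that of the \<open>q\<^sub>l\<close>: a single
  conjugation then inverts all the \<open>m\<^sub>l\<close> at once.\<close>

locale conjugation_power = group +
  fixes u b :: 'a and M :: nat
  assumes u_closed [simp]: "u \<in> carrier G" and b_closed [simp]: "b \<in> carrier G"
    and M_pos: "0 < M"
    and conj_u: "u \<otimes> b \<otimes> inv u = b [^] int M"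
begin

definition root :: "nat \<Rightarrow> 'a" where
  "root n = inv (u [^] n) \<otimes> b \<otimes> u [^] n"

text \<open>The choice of the fraction does not matter, by \<open>rat_power_fraction\<close> below.\<close>

definition rat_power :: "rat \<Rightarrow> 'a" where
  "rat_power r = (case SOME (a, n). r = of_int a / of_nat M ^ n of (a, n) \<Rightarrow> root n [^] (a::int))"

lemma root_closed [simp]: "root n \<in> carrier G"
  by (simp add: root_def)

lemma root_Suc: "root (Suc n) [^] int M = root n"
proof -
  let ?v = "u [^] n"
  have "root (Suc n) [^] int M = inv (u \<otimes> ?v) \<otimes> b [^] int M \<otimes> (u \<otimes> ?v)"
    using conj_int_pow[of "inv (u \<otimes> ?v)" b "int M"]
    by (simp add: root_def nat_pow_Suc2[symmetric] del: nat_pow_Suc)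
  also have "\<dots> = inv (u \<otimes> ?v) \<otimes> (u \<otimes> b \<otimes> inv u) \<otimes> (u \<otimes> ?v)"
    by (simp only: conj_u)
  also have "\<dots> = inv ?v \<otimes> ((inv u \<otimes> u) \<otimes> b \<otimes> (inv u \<otimes> u)) \<otimes> ?v"
    by (simp only: inv_mult_group m_assoc u_closed b_closed m_closed inv_closed nat_pow_closed)
  also have "\<dots> = root n"
    by (simp add: root_def m_assoc)
  finally show ?thesis .
qed

lemma root_add: "root (n + j) [^] (int M ^ j) = root n"
proof (induction j)
  case (Suc j)
  have "root (n + Suc j) [^] (int M ^ Suc j) = (root (Suc (n + j)) [^] int M) [^] (int M ^ j)"
    by (simp add: int_pow_pow)
  then show ?case using Suc by (simp add: root_Suc)
qed simp

lemma root_int_pow_eq: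
  assumes "(of_int a / of_nat M ^ n :: rat) = of_int c / of_nat M ^ j"
  shows "root n [^] a = root j [^] c"
proof -
  have "of_int (a * int M ^ j) = (of_int (c * int M ^ n) :: rat)"
    using assms M_pos by (simp add: field_simps)
  then have "a * int M ^ j = c * int M ^ n" by (rule of_int_eq_iff[THEN iffD1])
  then have "int M ^ j * a = int M ^ n * c" by (simp add: mult.commute)
  then have "(root (n + j) [^] (int M ^ j)) [^] a = (root (j + n) [^] (int M ^ n)) [^] c"
    by (simp add: int_pow_pow add.commute)
  then show ?thesis by (simp only: root_add)
qed

lemma rat_power_fraction: "rat_power (of_int a / of_nat M ^ n) = root n [^] a"
proof -
  let ?P = "\<lambda>(c, j). (of_int a / of_nat M ^ n :: rat) = of_int c / of_nat M ^ j"
  have "?P (SOME p. ?P p)" by (rule someI[of ?P "(a, n)"]) simp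
  then show ?thesis
    unfolding rat_power_def by (auto split: prod.splits intro: root_int_pow_eq[symmetric])
qed

lemma rat_power_closed: "r \<in> power_fractions M \<Longrightarrow> rat_power r \<in> carrier G"
  by (auto simp: power_fractions_def rat_power_fraction)

lemma rat_power_one: "rat_power 1 = b"
  using rat_power_fraction[of 1 0] by (simp add: root_def)

lemma rat_power_add:
  assumes "r \<in> power_fractions M" "s \<in> power_fractions M"
  shows "rat_power (r + s) = rat_power r \<otimes> rat_power s"
proof -
  obtain a c n where "r = of_int a / of_nat M ^ n" "s = of_int c / of_nat M ^ n"
    using power_fractions_common_denominator[OF M_pos assms] .
  moreover from this have "r + s = of_int (a + c) / of_nat M ^ n" by (simp add: add_divide_distrib)
  ultimately show ?thesis by (simp only: rat_power_fraction int_pow_mult root_closed)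
qed

lemma rat_power_zero: "rat_power 0 = \<one>"
  using rat_power_fraction[of 0 0] by simp

lemma rat_power_uminus:
  assumes "r \<in> power_fractions M"
  shows "rat_power (- r) = inv rat_power r"
  using rat_power_add[OF power_fractions_uminus[OF assms] assms] assms
  by (intro inv_equality[symmetric]) (auto simp: rat_power_zero rat_power_closed power_fractions_uminus)

text \<open>Elements whose conjugation action on the subgroup of the powers \<open>b\<^sup>r\<close> is multiplication of
  the exponent by \<open>s\<close>. The equation is free of inverses, so that it rewrites products
  of elements of \<open>B\<close> and \<open>Q\<close> to the normal form with the element of \<open>B\<close> on the left.\<close>

definition scales :: "'a \<Rightarrow> rat \<Rightarrow> bool" where
  "scales y s \<longleftrightarrow> y \<in> carrier G \<and> s \<in> power_fractions M \<and>
     (\<forall>r\<in>power_fractions M. y \<otimes> rat_power r = rat_power (s * r) \<otimes> y)"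

lemma scales_one: "scales \<one> 1"
  by (auto simp: scales_def rat_power_closed)

lemma scales_mult:
  assumes "scales y s" "scales z t"
  shows "scales (y \<otimes> z) (s * t)"
proof -
  have "y \<otimes> z \<otimes> rat_power r = rat_power (s * t * r) \<otimes> (y \<otimes> z)" if r: "r \<in> power_fractions M" for r
  proof -
    have tr: "t * r \<in> power_fractions M" using assms r by (auto simp: scales_def power_fractions_mult)
    have str: "s * (t * r) \<in> power_fractions M"
      using assms tr by (auto simp: scales_def power_fractions_mult)
    have yz: "y \<in> carrier G" "z \<in> carrier G" using assms by (auto simp: scales_def)
    have "y \<otimes> z \<otimes> rat_power r = y \<otimes> (rat_power (t * r) \<otimes> z)"
      using assms r yz by (simp add: m_assoc rat_power_closed scales_def)
    also have "\<dots> = rat_power (s * (t * r)) \<otimes> y \<otimes> z"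
      using assms tr yz by (simp add: rat_power_closed scales_def flip: m_assoc)
    finally show ?thesis using yz str by (simp add: m_assoc rat_power_closed mult.assoc)
  qed
  then show ?thesis using assms by (auto simp: scales_def power_fractions_mult)
qed

lemma scales_inv:
  assumes "scales y s" "s \<noteq> 0" "inverse s \<in> power_fractions M"
  shows "scales (inv y) (inverse s)"
proof -
  have y: "y \<in> carrier G" using assms by (auto simp: scales_def)
  have "inv y \<otimes> rat_power r = rat_power (inverse s * r) \<otimes> inv y" if r: "r \<in> power_fractions M" for r
  proof -
    have r': "inverse s * r \<in> power_fractions M" using assms r by (simp add: power_fractions_mult)
    then have "y \<otimes> rat_power (inverse s * r) = rat_power r \<otimes> y"
      using assms unfolding scales_def by (simp flip: mult.assoc)
    then have "rat_power r = y \<otimes> rat_power (inverse s * r) \<otimes> inv y"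
      using y r r' by (simp add: inv_solve_right rat_power_closed)
    then show ?thesis
      using y r r' by (simp add: inv_solve_left' rat_power_closed m_assoc)
  qed
  then show ?thesis using assms y by (auto simp: scales_def)
qed

lemma scales_int_pow:
  assumes "scales y (of_nat d)" "0 < d" "d dvd M"
  shows "scales (y [^] a) (of_nat d powi a)"
proof -
  have nat: "scales (z [^] n) (s ^ n)" if "scales z s" for z s and n :: nat
    using that by (induction n) (auto simp: scales_one scales_mult mult.commute[of s])
  have y: "y \<in> carrier G" using assms by (auto simp: scales_def)
  have "scales (inv y) (inverse (of_nat d))"
    using assms M_pos by (intro scales_inv power_fractions_inverse_dvd) auto
  from nat[OF this, of "nat (- a)"] nat[OF assms(1), of "nat a"] show ?thesis
    using y unfolding int_pow_def2 power_int_def by (auto simp: nat_pow_inv)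
qed

text \<open>An element that commutes with \<open>u\<close> acts on each root \<open>u\<^sup>-\<^sup>n b u\<^sup>n\<close> in the same way as on \<open>b\<close>.\<close>

lemma scales_of_conj:
  assumes y: "y \<in> carrier G" and yu: "y \<otimes> u = u \<otimes> y" and yb: "y \<otimes> b \<otimes> inv y = b [^] int d"
  shows "scales y (of_nat d)"
proof -
  have root: "y \<otimes> root n \<otimes> inv y = root n [^] int d" for n
  proof -
    let ?v = "u [^] n"
    have "y \<otimes> u [^] int n = u [^] int n \<otimes> y" using y yu by (intro int_pow_commute) auto
    then have yv: "y \<otimes> ?v = ?v \<otimes> y" by (simp add: int_pow_int)
    then have vy: "?v \<otimes> inv y = inv y \<otimes> ?v"
      using y by (metis inv_closed inv_solve_left inv_solve_right m_assoc m_closed nat_pow_closed u_closed)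
    have vy': "y \<otimes> inv ?v = inv ?v \<otimes> y"
      using y yv by (metis inv_closed inv_solve_left inv_solve_right m_assoc m_closed nat_pow_closed u_closed)
    have "y \<otimes> root n \<otimes> inv y = (y \<otimes> inv ?v) \<otimes> b \<otimes> (?v \<otimes> inv y)"
      using y by (simp add: root_def m_assoc)
    also have "\<dots> = inv ?v \<otimes> (y \<otimes> b \<otimes> inv y) \<otimes> ?v"
      using y by (simp add: vy vy' m_assoc)
    also have "\<dots> = root n [^] int d"
      using conj_int_pow[of "inv ?v" b "int d"] by (simp add: yb root_def)
    finally show ?thesis .
  qed
  have "y \<otimes> rat_power r = rat_power (of_nat d * r) \<otimes> y" if "r \<in> power_fractions M" for r
  proof -
    obtain a n where r: "r = of_int a / of_nat M ^ n" using \<open>r \<in> power_fractions M\<close> by (auto simp: power_fractions_def)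
    then have "of_nat d * r = of_int (int d * a) / of_nat M ^ n" by simp
    then have "rat_power (of_nat d * r) = root n [^] (int d * a)" by (simp only: rat_power_fraction)
    also have "\<dots> = (y \<otimes> root n \<otimes> inv y) [^] a" by (simp add: root int_pow_pow)
    also have "\<dots> = y \<otimes> rat_power r \<otimes> inv y"
      using y by (simp add: conj_int_pow r rat_power_fraction)
    finally show ?thesis using y that by (simp add: m_assoc rat_power_closed)
  qed
  then show ?thesis using y by (simp add: scales_def)
qed

end


section \<open>The affine group of the rationals\<close>

text \<open>The pair \<open>(a, b)\<close> stands for the map \<open>z \<mapsto> a * z + b\<close>.\<close>

definition affine_group :: "(rat \<times> rat) monoid" where
  "affine_group =
     \<lparr>carrier = {p. fst p \<noteq> 0},
      monoid.mult = (\<lambda>p p'. (fst p * fst p', fst p * snd p' + snd p)),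
      one = (1, 0)\<rparr>"

lemma affine_group_simps [simp]:
  "p \<in> carrier affine_group \<longleftrightarrow> fst p \<noteq> 0"
  "(a, b) \<otimes>\<^bsub>affine_group\<^esub> (c, d) = (a * c, a * d + b)"
  "\<one>\<^bsub>affine_group\<^esub> = (1, 0)"
  by (simp_all add: affine_group_def)

lemma group_affine_group: "group affine_group"
proof (rule groupI)
  fix p assume "p \<in> carrier affine_group"
  then show "\<exists>p'\<in>carrier affine_group. p' \<otimes>\<^bsub>affine_group\<^esub> p = \<one>\<^bsub>affine_group\<^esub>"
    by (cases p) (auto intro!: bexI[of _ "(inverse (fst p), - (snd p / fst p))"] simp: field_simps)
qed (auto simp: affine_group_def algebra_simps)

lemma affine_inv: "a \<noteq> 0 \<Longrightarrow> inv\<^bsub>affine_group\<^esub> (a, b) = (inverse a, - (b / a))"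
  by (intro group.inv_equality[OF group_affine_group]) (auto simp: field_simps)

lemma affine_nat_pow:
  "(a, 0) [^]\<^bsub>affine_group\<^esub> (n::nat) = (a ^ n, 0)"
  "(1, b) [^]\<^bsub>affine_group\<^esub> (n::nat) = (1, of_nat n * b)"
  by (induction n) (simp_all add: algebra_simps nat_pow_def)

lemma affine_int_pow:
  "a \<noteq> 0 \<Longrightarrow> (a, 0) [^]\<^bsub>affine_group\<^esub> (i::int) = (a powi i, 0)"
  "(1, b) [^]\<^bsub>affine_group\<^esub> (i::int) = (1, of_int i * b)"
  unfolding int_pow_def2 power_int_def by (auto simp: affine_nat_pow affine_inv power_inverse)


section \<open>The group \<open>G\<close> and its affine action\<close>

locale multiplier_tuple =
  fixes k :: nat and m :: "nat \<Rightarrow> nat"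
  assumes m_pos: "\<forall>l\<in>{1..k}. 0 < m l"
begin

definition mprod :: nat where "mprod = (\<Prod>l\<in>{1..k}. m l)"

text \<open>The factor by which the conjugation with \<open>qpow k m t\<close> multiplies the elements of \<open>B\<close>.\<close>

definition scale :: "(nat \<Rightarrow> int) \<Rightarrow> rat" where
  "scale t = (\<Prod>l\<in>{1..k}. of_nat (m l) powi t l)"

sublocale group "G k m"
  unfolding G_def by (rule group_presented_group)

abbreviation gmult (infixl "\<bullet>" 70) where "g \<bullet> h \<equiv> g \<otimes>\<^bsub>G k m\<^esub> h"

lemma gens_simps [simp]: "B0 \<in> gens k" "Q l \<in> gens k \<longleftrightarrow> l \<in> {1..k}"
  by (auto simp: gens_def)

lemma q_closed [simp]: "l \<in> {1..k} \<Longrightarrow> q k m l \<in> carrier (G k m)"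
  by (simp add: q_def G_def presented_carrier)

lemma b0_closed [simp]: "b0 k m \<in> carrier (G k m)"
  by (simp add: b0_def G_def presented_carrier)

lemma class_letter_inv:
  "l \<in> {1..k} \<Longrightarrow> pres_class (gens k) (rels k m) [(Q l, False)] = inv\<^bsub>G k m\<^esub> q k m l"
  "pres_class (gens k) (rels k m) [(B0, False)] = inv\<^bsub>G k m\<^esub> b0 k m"
  by (simp_all add: q_def b0_def G_def presented_letter_inv)

lemmas G_induct [consumes 1, case_names one letter] =
  presented_group_induct[of _ "gens k" "rels k m", folded G_def]

lemma class_Cons:
  assumes "fst p \<in> gens k" "w \<in> letters_over (gens k)"
  shows "pres_class (gens k) (rels k m) (p # w) =
    pres_class (gens k) (rels k m) [p] \<bullet> pres_class (gens k) (rels k m) w"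
  using assms by (simp add: G_def presented_mult)

lemma class_Nil: "pres_class (gens k) (rels k m) [] = \<one>\<^bsub>G k m\<^esub>"
  by (simp add: G_def presented_one)

lemma class_b0_power:
  "pres_class (gens k) (rels k m) (replicate n (B0, True)) = b0 k m [^]\<^bsub>G k m\<^esub> n"
proof (induction n)
  case (Suc n)
  have "pres_class (gens k) (rels k m) ((B0, True) # replicate n (B0, True)) =
      b0 k m \<bullet> (b0 k m [^]\<^bsub>G k m\<^esub> n)"
    using Suc class_Cons[of "(B0, True)" "replicate n (B0, True)"] by (simp add: b0_def)
  then show ?case by (simp only: replicate_Suc nat_pow_Suc2[OF b0_closed])
qed (simp add: class_Nil)

lemma q_conj_b0:
  assumes l: "l \<in> {1..k}"
  shows "q k m l \<bullet> b0 k m \<bullet> inv\<^bsub>G k m\<^esub> q k m l = b0 k m [^]\<^bsub>G k m\<^esub> int (m l)"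
proof -
  let ?c = "pres_class (gens k) (rels k m)"
  have "?c [(Q l, True), (B0, True), (Q l, False)] = ?c (replicate (m l) (B0, True))"
    using l by (intro presented_rel) (auto simp: rels_def)
  moreover have "?c [(Q l, True), (B0, True), (Q l, False)] =
      q k m l \<bullet> (b0 k m \<bullet> inv\<^bsub>G k m\<^esub> q k m l)"
    using l class_Cons[of "(Q l, True)" "[(B0, True), (Q l, False)]"]
      class_Cons[of "(B0, True)" "[(Q l, False)]"]
    by (simp add: class_letter_inv flip: q_def b0_def)
  ultimately show ?thesis using l by (simp add: m_assoc class_b0_power int_pow_int)
qed

lemma q_commute:
  assumes l: "l \<in> {1..k}" and j: "j \<in> {1..k}"
  shows "q k m l \<bullet> q k m j = q k m j \<bullet> q k m l"
proof -
  let ?c = "pres_class (gens k) (rels k m)"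
  let ?w = "[(Q l, True), (Q j, True), (Q l, False), (Q j, False)]"
  have "?c ?w = ?c []"
    using l j by (intro presented_rel) (auto simp: rels_def)
  moreover have "?c ?w =
      q k m l \<bullet> (q k m j \<bullet> (inv\<^bsub>G k m\<^esub> q k m l \<bullet> inv\<^bsub>G k m\<^esub> q k m j))"
    using l j class_Cons[of "(Q l, True)" "[(Q j, True), (Q l, False), (Q j, False)]"]
      class_Cons[of "(Q j, True)" "[(Q l, False), (Q j, False)]"]
      class_Cons[of "(Q l, False)" "[(Q j, False)]"]
    by (simp add: class_letter_inv flip: q_def)
  ultimately have "q k m l \<bullet> q k m j \<bullet> inv\<^bsub>G k m\<^esub> (q k m j \<bullet> q k m l) = \<one>\<^bsub>G k m\<^esub>"
    using l j by (simp add: m_assoc class_Nil inv_mult_group)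
  then show ?thesis using l j by (metis inv_equality inv_inv inv_closed m_closed q_closed)
qed

lemma qpow_power_product: "qpow k m t = power_product (G k m) (q k m) t [1..<Suc k]"
  by (simp add: qpow_def power_product_def)

lemma set_upt_subset: "set [1..<Suc k] \<subseteq> {1..k}"
  by auto

lemma prod_list_upt: "(\<Prod>l\<leftarrow>[1..<Suc k]. f l) = (\<Prod>l\<in>{1..k}. f l)"
  by (simp add: prod.distinct_set_conv_list[symmetric] atLeastLessThanSuc_atLeastAtMost del: upt_Suc)

lemma q_image_closed: "q k m ` set [1..<Suc k] \<subseteq> carrier (G k m)"
  by auto

lemma qpow_closed [simp]: "qpow k m t \<in> carrier (G k m)"
  unfolding qpow_power_product by (rule power_product_closed[OF q_image_closed])

lemma qpow_add: "qpow k m (\<lambda>l. s l + t l) = qpow k m s \<bullet> qpow k m t"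
  unfolding qpow_power_product by (intro power_product_add[OF q_image_closed] q_commute) auto

lemma qpow_zero: "qpow k m (\<lambda>l. 0) = \<one>\<^bsub>G k m\<^esub>"
proof -
  have "power_product (G k m) (q k m) (\<lambda>l. 0) ls = \<one>\<^bsub>G k m\<^esub>" for ls by (induction ls) auto
  then show ?thesis by (simp only: qpow_power_product)
qed

lemma qpow_uminus: "qpow k m (\<lambda>l. - t l) = inv\<^bsub>G k m\<^esub> qpow k m t"
  using qpow_add[of "\<lambda>l. - t l" t] by (intro inv_equality[symmetric]) (auto simp: qpow_zero)

lemma qpow_commute_q: "l \<in> {1..k} \<Longrightarrow> q k m l \<bullet> qpow k m t = qpow k m t \<bullet> q k m l"
  unfolding qpow_power_product by (intro power_product_commute[OF q_image_closed] q_commute) auto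

lemma q_eq_qpow: "l \<in> {1..k} \<Longrightarrow> q k m l = qpow k m (\<lambda>j. if j = l then 1 else 0)"
  unfolding qpow_power_product by (intro power_product_single[OF q_image_closed, symmetric]) auto

lemma Qgrp_eq: "Qgrp k m = range (qpow k m)"
proof
  show "Qgrp k m \<subseteq> range (qpow k m)"
  proof
    fix y assume "y \<in> Qgrp k m"
    then show "y \<in> range (qpow k m)" unfolding Qgrp_def
    proof (induction rule: generate.induct)
      case one
      show ?case unfolding qpow_zero[symmetric] by (rule rangeI)
    next
      case (incl h)
      then show ?case using q_eq_qpow by auto
    next
      case (inv h)
      then show ?case using q_eq_qpow by (auto simp flip: qpow_uminus)
    next
      case (eng h1 h2)
      then show ?case by (auto simp flip: qpow_add)
    qed
  qed
  have "subgroup (Qgrp k m) (G k m)"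
    unfolding Qgrp_def by (rule generate_is_subgroup) auto
  moreover have "q k m l \<in> Qgrp k m" if "l \<in> {1..k}" for l
    using that unfolding Qgrp_def by (auto intro: generate.incl)
  ultimately have "power_product (G k m) (q k m) t ls \<in> Qgrp k m" if "set ls \<subseteq> {1..k}" for t ls
    using that by (induction ls)
      (auto intro: subgroup.one_closed subgroup.m_closed subgroup_int_pow_closed)
  from this[OF set_upt_subset] show "range (qpow k m) \<subseteq> Qgrp k m"
    unfolding qpow_power_product by auto
qed

lemma subgroup_Qgrp: "subgroup (Qgrp k m) (G k m)"
  unfolding Qgrp_def by (rule generate_is_subgroup) auto

lemma mprod_pos: "0 < mprod"
  using m_pos by (auto simp: mprod_def intro: prod_pos)

lemma m_dvd_mprod: "l \<in> {1..k} \<Longrightarrow> m l dvd mprod"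
  unfolding mprod_def by (rule dvd_prodI) auto

lemma qpow_one_conj_b0:
  "qpow k m (\<lambda>l. 1) \<bullet> b0 k m \<bullet> inv\<^bsub>G k m\<^esub> qpow k m (\<lambda>l. 1) = b0 k m [^]\<^bsub>G k m\<^esub> int mprod"
proof -
  have "power_product (G k m) (q k m) (\<lambda>l. 1) ls \<bullet> b0 k m \<bullet> inv\<^bsub>G k m\<^esub> power_product (G k m) (q k m) (\<lambda>l. 1) ls
      = b0 k m [^]\<^bsub>G k m\<^esub> (\<Prod>l\<leftarrow>ls. int (m l))" if "set ls \<subseteq> {1..k}" for ls
    using that
  proof (induction ls)
    case (Cons l ls)
    let ?p = "power_product (G k m) (q k m) (\<lambda>l. 1) ls"
    have [simp]: "?p \<in> carrier (G k m)" "q k m l \<in> carrier (G k m)"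
      using Cons.prems by (auto intro!: power_product_closed q_closed)
    have "(q k m l \<bullet> ?p) \<bullet> b0 k m \<bullet> inv\<^bsub>G k m\<^esub> (q k m l \<bullet> ?p)
        = q k m l \<bullet> (?p \<bullet> b0 k m \<bullet> inv\<^bsub>G k m\<^esub> ?p) \<bullet> inv\<^bsub>G k m\<^esub> q k m l"
      by (simp add: inv_mult_group m_assoc)
    also have "\<dots> = q k m l \<bullet> (b0 k m [^]\<^bsub>G k m\<^esub> (\<Prod>l\<leftarrow>ls. int (m l))) \<bullet> inv\<^bsub>G k m\<^esub> q k m l"
      using Cons by simp
    also have "\<dots> = (b0 k m [^]\<^bsub>G k m\<^esub> int (m l)) [^]\<^bsub>G k m\<^esub> (\<Prod>l\<leftarrow>ls. int (m l))"
      using Cons.prems by (simp add: conj_int_pow q_conj_b0)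
    finally show ?case by (simp add: int_pow_pow)
  qed simp
  from this[OF set_upt_subset] show ?thesis
    unfolding qpow_power_product[of "\<lambda>l. 1"] prod_list_upt mprod_def of_nat_prod .
qed

text \<open>From here on \<open>rat_power\<close> is the embedding of \<open>B\<close> into \<open>G\<close>.\<close>

sublocale conjugation_power "G k m" "qpow k m (\<lambda>l. 1)" "b0 k m" mprod
  by unfold_locales (auto simp: qpow_one_conj_b0 mprod_pos)

lemma scales_q: "l \<in> {1..k} \<Longrightarrow> scales (q k m l) (of_nat (m l))"
  by (intro scales_of_conj qpow_commute_q q_conj_b0) auto

lemma scales_qpow: "scales (qpow k m t) (scale t)"
proof -
  have "scales (power_product (G k m) (q k m) t ls) (\<Prod>l\<leftarrow>ls. of_nat (m l) powi t l)"
    if "set ls \<subseteq> {1..k}" for ls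
    using that
  proof (induction ls)
    case (Cons l ls)
    then show ?case
      using m_pos by (auto intro!: scales_mult scales_int_pow scales_q m_dvd_mprod)
  qed (simp add: scales_one)
  from this[OF set_upt_subset] show ?thesis
    unfolding qpow_power_product[of t] prod_list_upt scale_def .
qed

lemma scale_one: "scale (\<lambda>l. 1) = of_nat mprod"
  by (simp add: scale_def mprod_def)

lemma scale_closed: "scale t \<in> power_fractions mprod"
  using scales_qpow by (simp add: scales_def)

text \<open>The set of the products \<open>cy\<close> with \<open>c\<close> in \<open>B\<close> and \<open>y\<close> in \<open>Q\<close> contains the identity and is stable
  under left multiplication by every letter: letters of \<open>Q\<close> move past \<open>c\<close> at the price of
  scaling it.\<close>

lemma G_decomposition:
  assumes "g \<in> carrier (G k m)"
  obtains c t where "c \<in> power_fractions mprod" "g = rat_power c \<bullet> qpow k m t"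
proof -
  have "\<exists>c\<in>power_fractions mprod. \<exists>t. g = rat_power c \<bullet> qpow k m t"
    using assms
  proof (induction rule: G_induct)
    case one
    then show ?case
      by (intro bexI[of _ 0] exI[of _ "\<lambda>l. 0"]) (simp_all add: qpow_zero rat_power_zero)
  next
    case (letter x e h)
    then obtain c t where c: "c \<in> power_fractions mprod" and h: "h = rat_power c \<bullet> qpow k m t" by auto
    have rat_power_step: "\<exists>d\<in>power_fractions mprod. \<exists>t. rat_power i \<bullet> h = rat_power d \<bullet> qpow k m t"
      if i: "i \<in> power_fractions mprod" for i
      using c i unfolding h
      by (intro bexI[of _ "i + c"] exI[of _ t])
        (auto simp: rat_power_add m_assoc rat_power_closed power_fractions_add[OF M_pos])
    have qpow_step: "\<exists>d\<in>power_fractions mprod. \<exists>t. qpow k m s \<bullet> h = rat_power d \<bullet> qpow k m t" for s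
    proof (intro bexI exI)
      have "qpow k m s \<bullet> h = rat_power (scale s * c) \<bullet> qpow k m s \<bullet> qpow k m t"
        using scales_qpow[of s] c unfolding h by (simp add: scales_def rat_power_closed flip: m_assoc)
      then show "qpow k m s \<bullet> h = rat_power (scale s * c) \<bullet> qpow k m (\<lambda>l. s l + t l)"
        using c scale_closed by (simp add: qpow_add m_assoc rat_power_closed power_fractions_mult)
      show "scale s * c \<in> power_fractions mprod" using c scale_closed by (simp add: power_fractions_mult)
    qed
    have i: "rat_power (-1) = inv\<^bsub>G k m\<^esub> b0 k m"
      using rat_power_uminus[of 1] by (simp add: rat_power_one)
    have j: "(-1::rat) \<in> power_fractions mprod" using power_fractions_uminus[of 1] by simp
    have q: "\<exists>s. pres_class (gens k) (rels k m) [(Q l, e)] = qpow k m s" if "l \<in> {1..k}" for l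
    proof (cases e)
      case True
      then show ?thesis using q_eq_qpow[OF that] by (auto simp flip: q_def)
    next
      case False
      then show ?thesis using q_eq_qpow[OF that] that
        by (auto simp: class_letter_inv simp flip: qpow_uminus)
    qed
    show ?case
    proof (cases x)
      case (Q l)
      with letter(1) obtain s where "pres_class (gens k) (rels k m) [(x, e)] = qpow k m s"
        using q[of l] by auto
      then show "\<exists>c\<in>power_fractions mprod. \<exists>t. pres_class (gens k) (rels k m) [(x, e)] \<bullet> h = rat_power c \<bullet> qpow k m t"
        using qpow_step by simp
    next
      case B0
      then show "\<exists>c\<in>power_fractions mprod. \<exists>t. pres_class (gens k) (rels k m) [(x, e)] \<bullet> h = rat_power c \<bullet> qpow k m t"
        using rat_power_step[of 1] rat_power_step[of "-1"] j
        by (cases e) (auto simp: class_letter_inv i rat_power_one simp flip: b0_def)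
    qed
  qed
  then show ?thesis using that by blast
qed

text \<open>The generator \<open>b\<^sub>0\<close> acts on \<open>\<rat>\<close> as the translation by \<open>1\<close> and \<open>q\<^sub>l\<close> as the multiplication by \<open>m\<^sub>l\<close>;
  the relations of \<open>G\<close> hold for these maps. Then \<open>B\<close> acts by translations and \<open>Q\<close> by maps that fix
  \<open>0\<close>. This is the only place where elements of \<open>G\<close> are shown to be different, and it gives
  both the injectivity of the embedding of \<open>B\<close> and the triviality of its intersection
  with \<open>Q\<close>.\<close>

lemma affine_action:
  obtains \<rho> where "\<rho> \<in> hom (G k m) affine_group"
    and "\<And>r. r \<in> power_fractions mprod \<Longrightarrow> \<rho> (rat_power r) = (1, r)"
    and "\<And>t. \<rho> (qpow k m t) = (scale t, 0)"
proof -
  interpret aff: group affine_group by (rule group_affine_group)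
  define f :: "gen \<Rightarrow> rat \<times> rat" where
    "f x = (case x of Q l \<Rightarrow> (of_nat (m l), 0) | B0 \<Rightarrow> (1, 1))" for x
  have f: "f \<in> gens k \<rightarrow> carrier affine_group"
    using m_pos by (auto simp: f_def gens_def)
  have rep: "word_value affine_group f (replicate n (B0, True)) = (1, of_nat n)" for n
    by (induction n) (auto simp: f_def)
  have "word_value affine_group f r = word_value affine_group f s" if "(r, s) \<in> rels k m" for r s
    using that m_pos by (auto simp: rels_def rep) (auto simp: f_def affine_inv field_simps)
  then obtain \<rho> where \<rho>: "\<rho> \<in> hom (G k m) affine_group"
    and \<rho>x: "\<And>x. x \<in> gens k \<Longrightarrow> \<rho> (pres_class (gens k) (rels k m) [(x, True)]) = f x"
    using aff.presented_group_lift[OF f] unfolding G_def by metis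
  interpret \<rho>: group_hom "G k m" affine_group \<rho>
    by unfold_locales (rule \<rho>)
  have q: "\<rho> (q k m l) = (of_nat (m l), 0)" if "l \<in> {1..k}" for l
    using that by (simp add: q_def \<rho>x f_def)
  have b0: "\<rho> (b0 k m) = (1, 1)"
    by (simp add: b0_def \<rho>x f_def)
  have "\<rho> (power_product (G k m) (q k m) t ls) = (\<Prod>l\<leftarrow>ls. of_nat (m l) powi t l, 0)"
    if "set ls \<subseteq> {1..k}" for t ls
    using that
  proof (induction ls)
    case (Cons l ls)
    then have "q k m l \<in> carrier (G k m)" "power_product (G k m) (q k m) t ls \<in> carrier (G k m)"
      by (auto intro!: power_product_closed q_closed)
    then show ?case
      using Cons m_pos by (auto simp: \<rho>.hom_int_pow q affine_int_pow)
  qed simp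
  from this[OF set_upt_subset] have qpow: "\<rho> (qpow k m t) = (scale t, 0)" for t
    unfolding qpow_power_product prod_list_upt scale_def .
  have "\<rho> (root n) = (1, 1 / of_nat mprod ^ n)" for n
    using M_pos by (simp add: root_def \<rho>.hom_nat_pow qpow b0 affine_nat_pow affine_inv scale_one
        field_simps)
  then have "\<rho> (rat_power r) = (1, r)" if "r \<in> power_fractions mprod" for r
    using that by (auto simp: power_fractions_def rat_power_fraction \<rho>.hom_int_pow affine_int_pow)
  with \<rho> qpow show ?thesis by (intro that)
qed

lemma rat_power_inj:
  assumes "r \<in> power_fractions mprod" "s \<in> power_fractions mprod" "rat_power r = rat_power s"
  shows "r = s"
proof -
  obtain \<rho> where "\<rho> \<in> hom (G k m) affine_group"
    and "\<And>r. r \<in> power_fractions mprod \<Longrightarrow> \<rho> (rat_power r) = (1, r)"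
    and "\<And>t. \<rho> (qpow k m t) = (scale t, 0)"
    using affine_action by blast
  then show ?thesis using assms by (metis prod.inject)
qed

lemma rat_power_eq_qpow:
  assumes "r \<in> power_fractions mprod" "rat_power r = qpow k m t"
  shows "r = 0"
proof -
  obtain \<rho> where "\<rho> \<in> hom (G k m) affine_group"
    and "\<And>r. r \<in> power_fractions mprod \<Longrightarrow> \<rho> (rat_power r) = (1, r)"
    and "\<And>t. \<rho> (qpow k m t) = (scale t, 0)"
    using affine_action by blast
  then show ?thesis using assms by (metis prod.inject)
qed

end


section \<open>The ring \<open>B\<close>\<close>

interpretation rat_ring: cring rat_ring
  by (rule cring_from_type_algebra)

lemma rat_ring_simps [simp]:
  "carrier rat_ring = UNIV" "x \<oplus>\<^bsub>rat_ring\<^esub> y = x + y" "x \<otimes>\<^bsub>rat_ring\<^esub> y = x * y"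
  "\<zero>\<^bsub>rat_ring\<^esub> = 0" "\<one>\<^bsub>rat_ring\<^esub> = 1"
  by (simp_all add: ring_of_type_algebra_def)

lemma rat_ring_a_inv [simp]: "\<ominus>\<^bsub>rat_ring\<^esub> x = - x"
  by (rule rat_ring.minus_equality) auto

context multiplier_tuple
begin

lemma Bring_simps [simp]:
  "x \<oplus>\<^bsub>Bring k m\<^esub> y = x + y" "x \<otimes>\<^bsub>Bring k m\<^esub> y = x * y"
  "\<zero>\<^bsub>Bring k m\<^esub> = 0" "\<one>\<^bsub>Bring k m\<^esub> = 1"
  using rat_ring_simps by (simp_all add: Bring_def)

lemma carrier_Bring: "carrier (Bring k m) = power_fractions mprod"
proof -
  let ?H = "(\<lambda>l. of_nat (m l)) ` {1..k} \<union> (\<lambda>l. inverse (of_nat (m l))) ` {1..k}"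
  let ?B = "generate_ring rat_ring ?H"
  have "r \<in> power_fractions mprod" if "r \<in> ?B" for r
    using that
  proof (induction rule: generate_ring.induct)
    case (incl h)
    then show ?case
      using power_fractions_inverse_dvd[OF mprod_pos m_dvd_mprod] by auto
  qed (auto intro: power_fractions_uminus power_fractions_add power_fractions_mult mprod_pos)
  moreover have "r \<in> ?B" if "r \<in> power_fractions mprod" for r
  proof -
    have mult: "x * y \<in> ?B" if "x \<in> ?B" "y \<in> ?B" for x y
      using generate_ring.eng_mult[OF that] by simp
    have one: "1 \<in> ?B" using generate_ring.one[of rat_ring ?H] by simp
    have nat: "of_nat n \<in> ?B" for n
    proof (induction n)
      case 0
      then show ?case using rat_ring.zero_in_generate[of ?H] by simp
    next
      case (Suc n)
      then show ?case using generate_ring.eng_add[OF one Suc] by simp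
    qed
    have int: "of_int a \<in> ?B" for a
      using nat[of "nat a"] generate_ring.a_inv[OF nat[of "nat (- a)"]] by (cases "a \<ge> 0") auto
    have pow: "x ^ n \<in> ?B" if "x \<in> ?B" for x and n :: nat
      by (induction n) (use that one mult in simp_all)
    have "(\<Prod>l\<in>A. inverse (of_nat (m l))) \<in> ?B" if "A \<subseteq> {1..k}" for A
      using finite_subset[OF that finite_atLeastAtMost] that
    proof (induction A rule: finite_induct)
      case (insert l A)
      have "inverse (of_nat (m l)) \<in> ?B"
        by (rule generate_ring.incl) (use insert in auto)
      then show ?case using mult insert by simp
    qed (use one in simp)
    moreover have "inverse (of_nat mprod) = (\<Prod>l\<in>{1..k}. inverse (of_nat (m l) :: rat))"
      by (simp add: mprod_def o_def flip: prod_inversef)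
    ultimately have "inverse (of_nat mprod) \<in> ?B" by simp
    then have "of_int a / of_nat mprod ^ n \<in> ?B" for a n
      using mult[OF int[of a] pow[of "inverse (of_nat mprod)" n]] by (simp add: divide_inverse power_inverse)
    then show ?thesis using that by (auto simp: power_fractions_def)
  qed
  ultimately show ?thesis by (auto simp: Bring_def)
qed

lemma cring_Bring: "cring (Bring k m)"
proof -
  have "ring (Bring k m)"
    unfolding Bring_def by (rule rat_ring.generate_ring_is_ring) simp
  then show ?thesis
    by (intro cring.intro comm_monoid.intro comm_monoid_axioms.intro) (auto simp: ring.is_monoid)
qed

lemma a_inv_Bring: "x \<in> power_fractions mprod \<Longrightarrow> \<ominus>\<^bsub>Bring k m\<^esub> x = - x"
  using cring_Bring
  by (intro abelian_group.minus_equality[OF ring.is_abelian_group[OF cring.axioms(1)]])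
    (auto simp: carrier_Bring power_fractions_uminus)

lemma a_minus_Bring:
  "\<lbrakk>x \<in> power_fractions mprod; y \<in> power_fractions mprod\<rbrakk> \<Longrightarrow> x \<ominus>\<^bsub>Bring k m\<^esub> y = x - y"
  by (simp add: a_minus_def a_inv_Bring)


section \<open>\<open>G\<close> as a semidirect product, and conjugacy in it\<close>

lemma rat_power_semidirect_identification: "semidirect_identification k m rat_power"
proof -
  let ?N = "rat_power ` power_fractions mprod"
  have N: "subgroup ?N (G k m)"
  proof (rule subgroupI)
    show "inv\<^bsub>G k m\<^esub> g \<in> ?N" if "g \<in> ?N" for g
      using that by (auto simp: power_fractions_uminus simp flip: rat_power_uminus)
    show "g \<bullet> h \<in> ?N" if "g \<in> ?N" "h \<in> ?N" for g h
      using that by (auto simp: power_fractions_add mprod_pos simp flip: rat_power_add)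
  qed (auto simp: rat_power_closed intro: zero_power_fractions)
  have "g \<bullet> h \<bullet> inv\<^bsub>G k m\<^esub> g \<in> ?N" if g: "g \<in> carrier (G k m)" and h: "h \<in> ?N" for g h
  proof -
    obtain c t where c: "c \<in> power_fractions mprod" and gc: "g = rat_power c \<bullet> qpow k m t"
      using G_decomposition[OF g] .
    obtain r where r: "r \<in> power_fractions mprod" and h: "h = rat_power r" using h by auto
    have sr: "scale t * r \<in> power_fractions mprod"
      using r scale_closed by (simp add: power_fractions_mult)
    have "g \<bullet> h = rat_power c \<bullet> rat_power (scale t * r) \<bullet> qpow k m t"
      using scales_qpow[of t] c r sr by (simp add: gc h m_assoc rat_power_closed scales_def)
    (* The image of B is commutative, so c disappears: only the Q-component of g acts on it. *)
    also have "rat_power c \<bullet> rat_power (scale t * r) = rat_power (scale t * r) \<bullet> rat_power c"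
      using c sr by (simp add: add.commute flip: rat_power_add)
    finally have "g \<bullet> h = rat_power (scale t * r) \<bullet> g"
      using c sr by (simp add: gc m_assoc rat_power_closed)
    then have "g \<bullet> h \<bullet> inv\<^bsub>G k m\<^esub> g = rat_power (scale t * r)"
      using conj_eq_iff_commute[of g h "rat_power (scale t * r)"] g r sr
      by (simp add: h rat_power_closed)
    then show ?thesis using sr by auto
  qed
  then have "?N \<lhd> G k m" using N by (simp add: normal_inv_iff)
  moreover have "?N \<inter> Qgrp k m = {\<one>\<^bsub>G k m\<^esub>}"
  proof
    show "?N \<inter> Qgrp k m \<subseteq> {\<one>\<^bsub>G k m\<^esub>}"
      using rat_power_eq_qpow rat_power_zero unfolding Qgrp_eq by blast
    show "{\<one>\<^bsub>G k m\<^esub>} \<subseteq> ?N \<inter> Qgrp k m"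
      using N subgroup_Qgrp by (auto intro: subgroup.one_closed)
  qed
  moreover have "?N <#>\<^bsub>G k m\<^esub> Qgrp k m = carrier (G k m)"
  proof
    show "?N <#>\<^bsub>G k m\<^esub> Qgrp k m \<subseteq> carrier (G k m)"
      by (auto simp: set_mult_def Qgrp_eq rat_power_closed)
    show "carrier (G k m) \<subseteq> ?N <#>\<^bsub>G k m\<^esub> Qgrp k m"
      by (auto simp: set_mult_def Qgrp_eq elim!: G_decomposition)
  qed
  moreover have "q k m l \<bullet> rat_power r \<bullet> inv\<^bsub>G k m\<^esub> q k m l = rat_power (act m l r)"
    if "l \<in> {1..k}" "r \<in> power_fractions mprod" for l r
    using that scales_q[OF that(1)]
      conj_eq_iff_commute[of "q k m l" "rat_power r" "rat_power (of_nat (m l) * r)"]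
    by (simp add: act_def scales_def rat_power_closed power_fractions_mult)
  moreover have "rat_power \<in> mon (add_monoid (Bring k m)) (G k m)"
    by (auto simp: mon_def hom_def carrier_Bring rat_power_closed rat_power_add
        intro!: inj_onI rat_power_inj)
  ultimately show ?thesis
    using subgroup_Qgrp
    unfolding semidirect_identification_def internal_semidirect_def
    by (simp add: carrier_Bring rat_power_one)
qed

text \<open>Both sides of \<open>(cy)(bx) = (b\<^sub>1x)(cy)\<close> are an element of \<open>B\<close> times \<open>xy = yx\<close>, and comparing these
  elements gives the equation.\<close>

lemma conjugates_iff:
  assumes k: "1 \<le> k"
    and b: "b \<in> power_fractions mprod" and b1: "b1 \<in> power_fractions mprod"
    and c: "c \<in> power_fractions mprod"
  shows "conjugates (G k m) (rat_power c \<bullet> qpow k m t)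
      (rat_power b \<bullet> q k m 1) (rat_power b1 \<bullet> q k m 1)
    \<longleftrightarrow> c + scale t * b = b1 + of_nat (m 1) * c"
proof -
  let ?x = "q k m 1" and ?y = "qpow k m t"
  have x: "?x \<in> carrier (G k m)" using k by simp
  have sb: "scale t * b \<in> power_fractions mprod" and mc: "of_nat (m 1) * c \<in> power_fractions mprod"
    using b c scale_closed by (auto intro: power_fractions_mult)
  have "(rat_power c \<bullet> ?y) \<bullet> (rat_power b \<bullet> ?x) = rat_power c \<bullet> (?y \<bullet> rat_power b) \<bullet> ?x"
    using b c x by (simp add: m_assoc rat_power_closed)
  also have "\<dots> = rat_power (c + scale t * b) \<bullet> (?y \<bullet> ?x)"
    using scales_qpow[of t] b c x sb
    by (simp add: m_assoc rat_power_closed rat_power_add scales_def)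
  finally have l: "(rat_power c \<bullet> ?y) \<bullet> (rat_power b \<bullet> ?x) =
    rat_power (c + scale t * b) \<bullet> (?y \<bullet> ?x)" .
  have "(rat_power b1 \<bullet> ?x) \<bullet> (rat_power c \<bullet> ?y) = rat_power b1 \<bullet> (?x \<bullet> rat_power c) \<bullet> ?y"
    using b1 c x by (simp add: m_assoc rat_power_closed)
  also have "\<dots> = rat_power (b1 + of_nat (m 1) * c) \<bullet> (?x \<bullet> ?y)"
    using scales_q[of 1] k b1 c x mc
    by (simp add: m_assoc rat_power_closed rat_power_add scales_def)
  also have "?x \<bullet> ?y = ?y \<bullet> ?x" using k by (intro qpow_commute_q) auto
  finally have r: "(rat_power b1 \<bullet> ?x) \<bullet> (rat_power c \<bullet> ?y) =
    rat_power (b1 + of_nat (m 1) * c) \<bullet> (?y \<bullet> ?x)" .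
  have "conjugates (G k m) (rat_power c \<bullet> ?y) (rat_power b \<bullet> ?x) (rat_power b1 \<bullet> ?x)
      \<longleftrightarrow> rat_power (c + scale t * b) \<bullet> (?y \<bullet> ?x) = rat_power (b1 + of_nat (m 1) * c) \<bullet> (?y \<bullet> ?x)"
    unfolding conjugates_def l[symmetric] r[symmetric] using b b1 c x
    by (intro conj_eq_iff_commute) (auto simp: rat_power_closed)
  also have "\<dots> \<longleftrightarrow> rat_power (c + scale t * b) = rat_power (b1 + of_nat (m 1) * c)"
    using b1 c x sb mc
    by (intro right_cancel) (auto simp: rat_power_closed power_fractions_add mprod_pos)
  also have "\<dots> \<longleftrightarrow> c + scale t * b = b1 + of_nat (m 1) * c"
    using b1 c sb mc rat_power_inj by (auto simp: power_fractions_add mprod_pos)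
  finally show ?thesis .
qed

end


section \<open>The residue ring of \<open>B\<close>\<close>

text \<open>By this uniqueness an isomorphism from the quotient of \<open>B\<close> to the ring of residues must
  send the class of an integer to its residue, whichever isomorphism it is.\<close>

lemma int_ring_hom_unique:
  assumes "ring R" "f \<in> ring_hom \<Z> R" "g \<in> ring_hom \<Z> R"
  shows "f a = g a"
proof -
  interpret R: ring R by fact
  have one: "f 1 = \<one>\<^bsub>R\<^esub>" "g 1 = \<one>\<^bsub>R\<^esub>"
    using ring_hom_one[OF assms(2)] ring_hom_one[OF assms(3)] by simp_all
  have zero: "f 0 = \<zero>\<^bsub>R\<^esub>" "g 0 = \<zero>\<^bsub>R\<^esub>"
    using ring_hom_zero[OF assms(2) int.ring_axioms assms(1)]
      ring_hom_zero[OF assms(3) int.ring_axioms assms(1)] by simp_all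
  have closed: "f i \<in> carrier R" "g i \<in> carrier R" for i
    using ring_hom_closed[OF assms(2)] ring_hom_closed[OF assms(3)] by simp_all
  have Suc: "f (i + 1) = f i \<oplus>\<^bsub>R\<^esub> \<one>\<^bsub>R\<^esub>" "g (i + 1) = g i \<oplus>\<^bsub>R\<^esub> \<one>\<^bsub>R\<^esub>" for i
    using ring_hom_add[OF assms(2), of i 1] ring_hom_add[OF assms(3), of i 1] one by simp_all
  show ?thesis
  proof (induction a rule: int_induct[where k = 0])
    case (step2 i)
    then have "f (i - 1) \<oplus>\<^bsub>R\<^esub> \<one>\<^bsub>R\<^esub> = g (i - 1) \<oplus>\<^bsub>R\<^esub> \<one>\<^bsub>R\<^esub>"
      using Suc[of "i - 1"] by simp
    then show ?case using closed by simp
  qed (simp_all add: zero Suc)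
qed

lemma ZMod_ring_hom: "ZMod n \<in> ring_hom \<Z> (ZFact n)"
proof -
  have "ideal (Idl\<^bsub>\<Z>\<^esub> {n}) \<Z>" by (rule int.genideal_ideal) simp
  from ideal.rcos_ring_hom[OF this] show ?thesis
    by (simp add: ZMod_def[abs_def] ZFact_def)
qed

locale coprime_multipliers = multiplier_tuple +
  assumes k_pos: "1 \<le> k"
    and coprime_m: "\<forall>l\<in>{1..k}. coprime (int (m l)) (1 - int (m 1))"
begin

abbreviation n :: int where "n \<equiv> 1 - int (m 1)"
abbreviation I :: "rat set" where "I \<equiv> one_minus_x_B k m"

lemma I_eq: "I = {c * (1 - of_nat (m 1)) | c. c \<in> power_fractions mprod}"
  by (auto simp: one_minus_x_B_def act_def carrier_Bring algebra_simps)

lemma I_cgenideal: "I = PIdl\<^bsub>Bring k m\<^esub> (1 - of_nat (m 1))"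
  by (simp add: I_eq cgenideal_def carrier_Bring)

lemma ideal_I: "ideal I (Bring k m)"
  unfolding I_cgenideal
  by (intro cring.cgenideal_ideal cring_Bring) (simp add: carrier_Bring power_fractions_diff mprod_pos)

lemma cring_Bbar: "cring (Bbar k m)"
  unfolding Bbar_def by (rule ideal.quotient_is_cring[OF ideal_I cring_Bring])

lemma bar_ring_hom: "bar k m \<in> ring_hom (Bring k m) (Bbar k m)"
  using ideal.rcos_ring_hom[OF ideal_I] by (simp add: bar_def[abs_def] Bbar_def)

lemma bar_eq_iff:
  "\<lbrakk>x \<in> power_fractions mprod; y \<in> power_fractions mprod\<rbrakk>
    \<Longrightarrow> bar k m x = bar k m y \<longleftrightarrow> x - y \<in> I"
  using ring.quotient_eq_iff_same_a_r_cos[OF cring.axioms(1)[OF cring_Bring] ideal_I, of x y]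
  by (simp add: bar_def a_minus_Bring carrier_Bring)

lemma coprime_mprod: "coprime (int mprod) n"
  using coprime_m by (auto simp: mprod_def intro: prod_coprime_left)

text \<open>Denominators are powers of the product of the \<open>m\<^sub>l\<close>, which is coprime to \<open>1 - m\<^sub>1\<close>, so clearing
  them does not affect divisibility by \<open>1 - m\<^sub>1\<close>. Hence the map from \<open>\<int>\<close> to the quotient of \<open>B\<close>
  has the kernel generated by \<open>1 - m\<^sub>1\<close>.\<close>

lemma of_int_mem_I_iff: "of_int a \<in> I \<longleftrightarrow> n dvd a"
proof
  assume "of_int a \<in> I"
  then obtain c j where "(of_int a :: rat) = of_int c / of_nat mprod ^ j * (1 - of_nat (m 1))"
    by (auto simp: I_eq power_fractions_def)
  then have "(of_int (a * int mprod ^ j) :: rat) = of_int (c * n)"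
    using mprod_pos by (simp add: field_simps)
  then have "a * int mprod ^ j = c * n" by (rule of_int_eq_iff[THEN iffD1])
  then have "n dvd a * int mprod ^ j" by simp
  moreover have "coprime n (int mprod ^ j)"
    using coprime_mprod by (simp add: coprime_commute)
  ultimately show "n dvd a" using coprime_dvd_mult_left_iff by blast
next
  assume "n dvd a"
  then obtain c where "a = n * c" by auto
  then have "of_int a = (of_int c * (1 - of_nat (m 1)) :: rat)" by simp
  then show "of_int a \<in> I" by (auto simp: I_eq)
qed

text \<open>A denominator that is invertible modulo \<open>1 - m\<^sub>1\<close> can be replaced by its inverse residue, so the
  map from \<open>\<int>\<close> to the quotient of \<open>B\<close> is surjective.\<close>

lemma bar_eq_bar_of_int:
  assumes "r \<in> power_fractions mprod"
  obtains a where "bar k m r = bar k m (of_int a)"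
proof -
  obtain c j where r: "r = of_int c / of_nat mprod ^ j"
    using assms by (auto simp: power_fractions_def)
  have "coprime (int mprod ^ j) n" using coprime_mprod by simp
  then obtain d e where "d * int mprod ^ j + e * n = 1"
    using bezout_int[of "int mprod ^ j" n] by auto
  then have "e * n = 1 - d * int mprod ^ j" by simp
  then have "(of_int (e * n) :: rat) = of_int (1 - d * int mprod ^ j)" by (simp only:)
  then have "of_int e * (1 - of_nat (m 1)) = (1 - of_int d * of_nat mprod ^ j :: rat)" by simp
  then have "of_int (c * e) / of_nat mprod ^ j * (1 - of_nat (m 1)) =
      of_int c * (1 - of_int d * of_nat mprod ^ j :: rat) / of_nat mprod ^ j"
    by (simp add: mult.assoc)
  also have "\<dots> = r - of_int (c * d)"
    using mprod_pos by (simp add: r field_simps)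
  finally have "r - of_int (c * d) \<in> I"
    using power_fractionsI[of "c * e" mprod j] unfolding I_eq by (metis (mono_tags, lifting) mem_Collect_eq)
  then have "bar k m r = bar k m (of_int (c * d))"
    by (simp only: bar_eq_iff[OF assms of_int_power_fractions])
  then show ?thesis by (rule that)
qed

lemma of_int_ring_hom: "of_int \<in> ring_hom \<Z> (Bring k m)"
  by (rule ring_hom_memI) (auto simp: carrier_Bring)

lemma Bbar_iso_ZFact: "Bbar k m \<simeq> ZFact n"
proof -
  interpret Bbar: cring "Bbar k m" by (rule cring_Bbar)
  let ?h = "bar k m \<circ> of_int"
  have h: "?h \<in> ring_hom \<Z> (Bbar k m)"
    by (rule ring_hom_trans[OF of_int_ring_hom bar_ring_hom])
  interpret h: ring_hom_ring \<Z> "Bbar k m" ?h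
    by (rule ring_hom_ringI2[OF int.ring_axioms Bbar.ring_axioms h])
  have zero: "\<zero>\<^bsub>Bbar k m\<^esub> = bar k m 0"
    using ring_hom_zero[OF bar_ring_hom cring.axioms(1)[OF cring_Bring] Bbar.ring_axioms] by simp
  have "a_kernel \<Z> (Bbar k m) ?h = {a. of_int a \<in> I}"
    by (auto simp: a_kernel_def' zero bar_eq_iff)
  then have ker: "a_kernel \<Z> (Bbar k m) ?h = Idl\<^bsub>\<Z>\<^esub> {n}"
    by (auto simp: of_int_mem_I_iff int_Idl dvd_def mult.commute)
  have carrier: "carrier (Bbar k m) = bar k m ` power_fractions mprod"
    by (auto simp: Bbar_def FactRing_def A_RCOSETS_def' bar_def carrier_Bring)
  have "range ?h = carrier (Bbar k m)"
    unfolding carrier by (auto elim!: bar_eq_bar_of_int)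
  from h.FactRing_iso[OF this] have "ZFact n \<simeq> Bbar k m"
    by (simp add: ker ZFact_def)
  then show ?thesis by (rule ring_iso_sym[OF cring.axioms(1)[OF ZFact_is_cring]])
qed

end


section \<open>Ring homomorphisms from \<open>B\<close>\<close>

lemma (in comm_monoid) finprod_single: "f a \<in> carrier G \<Longrightarrow> finprod G f {a} = f a"
  by simp

locale Bring_hom = multiplier_tuple k m + R: cring R
  for k m and R :: "('r, 's) ring_scheme" +
  fixes \<phi> :: "rat \<Rightarrow> 'r"
  assumes \<phi>: "\<phi> \<in> ring_hom (Bring k m) R"
begin

lemma \<phi>_closed: "r \<in> power_fractions mprod \<Longrightarrow> \<phi> r \<in> carrier R"
  using ring_hom_closed[OF \<phi>] by (simp add: carrier_Bring)

lemma \<phi>_mult: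
  "\<lbrakk>r \<in> power_fractions mprod; s \<in> power_fractions mprod\<rbrakk> \<Longrightarrow> \<phi> (r * s) = \<phi> r \<otimes>\<^bsub>R\<^esub> \<phi> s"
  using ring_hom_mult[OF \<phi>] by (simp add: carrier_Bring)

lemma \<phi>_one: "\<phi> 1 = \<one>\<^bsub>R\<^esub>"
  using ring_hom_one[OF \<phi>] by simp

lemma \<phi>_power:
  assumes "r \<in> power_fractions mprod"
  shows "\<phi> (r ^ j) = \<phi> r [^]\<^bsub>R\<^esub> j" and "r ^ j \<in> power_fractions mprod"
proof -
  have "\<phi> (r ^ j) = \<phi> r [^]\<^bsub>R\<^esub> j \<and> r ^ j \<in> power_fractions mprod"
    using assms by (induction j) (auto simp: \<phi>_one \<phi>_mult \<phi>_closed R.m_comm power_fractions_mult)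
  then show "\<phi> (r ^ j) = \<phi> r [^]\<^bsub>R\<^esub> j" "r ^ j \<in> power_fractions mprod" by auto
qed

lemma \<phi>_inverse:
  assumes "r \<in> power_fractions mprod" "inverse r \<in> power_fractions mprod" "r \<noteq> 0"
  shows "inv\<^bsub>R\<^esub> \<phi> r = \<phi> (inverse r)" and "\<phi> r \<in> Units R"
proof -
  have one: "\<phi> r \<otimes>\<^bsub>R\<^esub> \<phi> (inverse r) = \<one>\<^bsub>R\<^esub>"
    using assms by (simp add: \<phi>_one flip: \<phi>_mult)
  then show "inv\<^bsub>R\<^esub> \<phi> r = \<phi> (inverse r)"
    using assms by (intro R.comm_inv_char) (auto simp: \<phi>_closed)
  show "\<phi> r \<in> Units R"
    using assms one R.m_comm[of "\<phi> r" "\<phi> (inverse r)"] by (auto simp: Units_def \<phi>_closed)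
qed

lemma inverse_m_closed: "l \<in> {1..k} \<Longrightarrow> inverse (of_nat (m l)) \<in> power_fractions mprod"
  by (rule power_fractions_inverse_dvd[OF mprod_pos m_dvd_mprod])

lemma \<phi>_m_Units: "l \<in> {1..k} \<Longrightarrow> \<phi> (of_nat (m l)) \<in> Units R"
  using m_pos \<phi>_inverse(2)[OF _ inverse_m_closed] by auto

lemma \<phi>_powi:
  assumes l: "l \<in> {1..k}"
  shows "\<phi> (of_nat (m l) powi a) = \<phi> (of_nat (m l)) [^]\<^bsub>R\<^esub> a"
proof (cases "a < 0")
  case True
  let ?r = "(of_nat (m l) :: rat) ^ nat (- a)"
  have "?r \<in> power_fractions mprod" "inverse ?r \<in> power_fractions mprod"
    using \<phi>_power(2)[of "of_nat (m l)"] \<phi>_power(2)[OF inverse_m_closed[OF l]]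
    by (auto simp flip: power_inverse)
  moreover have "?r \<noteq> 0" using m_pos l by auto
  ultimately have "\<phi> (inverse ?r) = inv\<^bsub>R\<^esub> \<phi> ?r" by (rule \<phi>_inverse(1)[symmetric])
  also have "\<phi> ?r = \<phi> (of_nat (m l)) [^]\<^bsub>R\<^esub> nat (- a)"
    by (simp add: \<phi>_power)
  finally show ?thesis
    using True unfolding int_pow_def2 power_int_def by (simp add: power_inverse)
next
  case False
  then show ?thesis
    unfolding int_pow_def2 power_int_def by (simp add: \<phi>_power)
qed

lemma powi_closed: "l \<in> {1..k} \<Longrightarrow> of_nat (m l) powi a \<in> power_fractions mprod"
  by (rule power_fractions_powi[OF mprod_pos m_dvd_mprod])

lemma \<phi>_m_powi_closed: "l \<in> {1..k} \<Longrightarrow> \<phi> (of_nat (m l)) [^]\<^bsub>R\<^esub> (a::int) \<in> carrier R"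
  using \<phi>_powi \<phi>_closed powi_closed by metis

lemma \<phi>_prod_powi:
  assumes "A \<subseteq> {1..k}"
  shows "\<phi> (\<Prod>l\<in>A. of_nat (m l) powi t l) = (\<Otimes>\<^bsub>R\<^esub>l\<in>A. \<phi> (of_nat (m l)) [^]\<^bsub>R\<^esub> t l)"
    and "(\<Prod>l\<in>A. of_nat (m l) powi t l) \<in> power_fractions mprod"
proof -
  have "\<phi> (\<Prod>l\<in>A. of_nat (m l) powi t l) = (\<Otimes>\<^bsub>R\<^esub>l\<in>A. \<phi> (of_nat (m l)) [^]\<^bsub>R\<^esub> t l)
      \<and> (\<Prod>l\<in>A. of_nat (m l) powi t l) \<in> power_fractions mprod"
    using finite_subset[OF assms finite_atLeastAtMost] assms
  proof (induction A rule: finite_induct)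
    case (insert l A)
    then have "(\<lambda>l. \<phi> (of_nat (m l)) [^]\<^bsub>R\<^esub> t l) \<in> A \<rightarrow> carrier R" and l: "l \<in> {1..k}"
      using \<phi>_m_powi_closed by auto
    then show ?case
      using insert \<phi>_m_powi_closed[OF l] powi_closed[OF l] \<phi>_powi[OF l]
      by (simp add: \<phi>_mult power_fractions_mult)
  qed (simp add: \<phi>_one)
  then show "\<phi> (\<Prod>l\<in>A. of_nat (m l) powi t l) = (\<Otimes>\<^bsub>R\<^esub>l\<in>A. \<phi> (of_nat (m l)) [^]\<^bsub>R\<^esub> t l)"
    "(\<Prod>l\<in>A. of_nat (m l) powi t l) \<in> power_fractions mprod" by auto
qed

text \<open>The factor of the index \<open>1\<close> disappears because \<open>m\<^sub>1\<close> becomes \<open>1\<close>; in the application this is the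
  congruence of \<open>m\<^sub>1\<close> and \<open>1\<close> modulo \<open>1 - m\<^sub>1\<close>.\<close>

lemma \<phi>_scale:
  assumes k: "1 \<le> k" and one: "\<phi> (of_nat (m 1)) = \<one>\<^bsub>R\<^esub>"
  shows "\<phi> (scale t) = (\<Otimes>\<^bsub>R\<^esub>l\<in>{2..k}. \<phi> (of_nat (m l)) [^]\<^bsub>R\<^esub> t l)"
proof -
  have 1: "1 \<in> {1..k}" and sub: "{2..k} \<subseteq> {1..k}" and split: "{1..k} = insert 1 {2..k}"
    using k by auto
  have "scale t = of_nat (m 1) powi t 1 * (\<Prod>l\<in>{2..k}. of_nat (m l) powi t l)"
    unfolding scale_def split by simp
  then have "\<phi> (scale t) = \<phi> (of_nat (m 1) powi t 1) \<otimes>\<^bsub>R\<^esub> \<phi> (\<Prod>l\<in>{2..k}. of_nat (m l) powi t l)"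
    by (simp only: \<phi>_mult powi_closed[OF 1] \<phi>_prod_powi(2)[OF sub])
  also have "\<phi> (of_nat (m 1) powi t 1) = \<one>\<^bsub>R\<^esub>"
    unfolding \<phi>_powi[OF 1] one int_pow_def2 by (simp add: R.comm_inv_char)
  also have "\<one>\<^bsub>R\<^esub> \<otimes>\<^bsub>R\<^esub> \<phi> (\<Prod>l\<in>{2..k}. of_nat (m l) powi t l) = \<phi> (\<Prod>l\<in>{2..k}. of_nat (m l) powi t l)"
    by (rule R.l_one[OF \<phi>_closed[OF \<phi>_prod_powi(2)[OF sub]]])
  finally show ?thesis using \<phi>_prod_powi(1)[OF sub] by simp
qed

end


section \<open>Conjugators and congruences\<close>

context coprime_multipliers
begin

abbreviation Z :: "int set ring" where "Z \<equiv> ZFact n"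
abbreviation mbar :: "nat \<Rightarrow> int set" where "mbar l \<equiv> ZMod n (int (m l))"

lemma mbar_1: "mbar 1 = \<one>\<^bsub>Z\<^esub>"
proof -
  have "mbar 1 = ZMod n 1"
    unfolding ZMod_eq_mod mod_eq_dvd_iff by (simp add: dvd_diff_commute)
  also have "\<dots> = \<one>\<^bsub>Z\<^esub>" using ring_hom_one[OF ZMod_ring_hom] by simp
  finally show ?thesis .
qed

lemma residue_hom:
  assumes "\<psi> \<in> ring_iso (Bbar k m) Z"
  shows "Bring_hom k m Z (\<lambda>b. \<psi> (bar k m b))" and "\<psi> (bar k m (of_nat (m l))) = mbar l"
proof -
  have "\<psi> \<in> ring_hom (Bbar k m) Z" using assms by (simp add: ring_iso_def)
  from ring_hom_trans[OF bar_ring_hom this]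
  have hom: "(\<lambda>b. \<psi> (bar k m b)) \<in> ring_hom (Bring k m) Z" by (simp add: o_def)
  then show "Bring_hom k m Z (\<lambda>b. \<psi> (bar k m b))"
    by (intro Bring_hom.intro Bring_hom_axioms.intro multiplier_tuple_axioms ZFact_is_cring)
  show "\<psi> (bar k m (of_nat (m l))) = mbar l"
    using int_ring_hom_unique[OF cring.axioms(1)[OF ZFact_is_cring]
        ring_hom_trans[OF of_int_ring_hom hom] ZMod_ring_hom, of "int (m l)"]
    by simp
qed

lemma mbar_Units: "\<forall>l\<in>{1..k}. mbar l \<in> Units Z"
proof -
  obtain \<psi> where \<psi>: "\<psi> \<in> ring_iso (Bbar k m) Z"
    using Bbar_iso_ZFact by (auto simp: is_ring_iso_def)
  from Bring_hom.\<phi>_m_Units[OF residue_hom(1)[OF \<psi>]] show ?thesis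
    unfolding residue_hom(2)[OF \<psi>] by blast
qed

text \<open>The unknown \<open>c\<close> enters the equation of \<open>conjugates_iff\<close> only through \<open>c - m\<^sub>1c\<close>, an arbitrary
  element of \<open>(1 - x)B\<close>. So a suitable \<open>c\<close> exists if and only if the remaining terms agree modulo
  \<open>(1 - x)B\<close>.\<close>

lemma conjugator_exists_iff:
  assumes \<psi>: "\<psi> \<in> ring_iso (Bbar k m) Z"
    and b: "b \<in> power_fractions mprod" and b1: "b1 \<in> power_fractions mprod"
  shows "(\<exists>c\<in>power_fractions mprod. conjugates (G k m) (rat_power c \<bullet> qpow k m t)
        (rat_power b \<bullet> q k m 1) (rat_power b1 \<bullet> q k m 1))
    \<longleftrightarrow> (\<Otimes>\<^bsub>Z\<^esub>l\<in>{2..k}. mbar l [^]\<^bsub>Z\<^esub> t l) \<otimes>\<^bsub>Z\<^esub> \<psi> (bar k m b) = \<psi> (bar k m b1)"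
    (is "?L \<longleftrightarrow> ?R")
proof -
  interpret \<phi>: Bring_hom k m Z "\<lambda>b. \<psi> (bar k m b)"
    by (rule residue_hom(1)[OF \<psi>])
  have sb: "scale t * b \<in> power_fractions mprod"
    using b scale_closed by (rule power_fractions_mult[rotated])
  have bar_closed: "bar k m r \<in> carrier (Bbar k m)" if "r \<in> power_fractions mprod" for r
    using ring_hom_closed[OF bar_ring_hom] that by (simp add: carrier_Bring)
  have "?L \<longleftrightarrow> (\<exists>c\<in>power_fractions mprod. c + scale t * b = b1 + of_nat (m 1) * c)"
    using conjugates_iff[OF k_pos b b1] by blast
  also have "\<dots> \<longleftrightarrow> scale t * b - b1 \<in> I"
  proof
    assume "\<exists>c\<in>power_fractions mprod. c + scale t * b = b1 + of_nat (m 1) * c"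
    then obtain c where "c \<in> power_fractions mprod" "c + scale t * b = b1 + of_nat (m 1) * c" by auto
    then have "scale t * b - b1 = (- c) * (1 - of_nat (m 1))" "- c \<in> power_fractions mprod"
      by (simp_all add: algebra_simps power_fractions_uminus)
    then show "scale t * b - b1 \<in> I" unfolding I_eq by blast
  next
    assume "scale t * b - b1 \<in> I"
    then obtain c where "c \<in> power_fractions mprod" "scale t * b - b1 = c * (1 - of_nat (m 1))"
      unfolding I_eq by blast
    then show "\<exists>c\<in>power_fractions mprod. c + scale t * b = b1 + of_nat (m 1) * c"
      by (intro bexI[of _ "- c"]) (simp_all add: algebra_simps power_fractions_uminus)
  qed
  also have "\<dots> \<longleftrightarrow> bar k m (scale t * b) = bar k m b1"
    using sb b1 by (simp add: bar_eq_iff)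
  also have "\<dots> \<longleftrightarrow> \<psi> (bar k m (scale t * b)) = \<psi> (bar k m b1)"
    using ring_iso_memE(5)[OF \<psi>] bar_closed[OF sb] bar_closed[OF b1]
    by (auto simp: bij_betw_def dest: inj_onD)
  also have "\<psi> (bar k m (scale t * b)) = \<psi> (bar k m (scale t)) \<otimes>\<^bsub>Z\<^esub> \<psi> (bar k m b)"
    by (rule \<phi>.\<phi>_mult[OF scale_closed b])
  also have "\<psi> (bar k m (scale t)) = (\<Otimes>\<^bsub>Z\<^esub>l\<in>{2..k}. mbar l [^]\<^bsub>Z\<^esub> t l)"
    using \<phi>.\<phi>_scale[OF k_pos] unfolding residue_hom(2)[OF \<psi>] by (simp only: mbar_1)
  finally show ?thesis .
qed

lemma qpow_mem_conjugator_Q_components_iff: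
  assumes "\<psi> \<in> ring_iso (Bbar k m) Z" "b \<in> power_fractions mprod" "b1 \<in> power_fractions mprod"
  shows "qpow k m t \<in> conjugator_Q_components k m rat_power b b1
    \<longleftrightarrow> (\<Otimes>\<^bsub>Z\<^esub>l\<in>{2..k}. mbar l [^]\<^bsub>Z\<^esub> t l) \<otimes>\<^bsub>Z\<^esub> \<psi> (bar k m b) = \<psi> (bar k m b1)"
  using conjugator_exists_iff[OF assms]
  by (simp only: conjugator_Q_components_def carrier_Bring Qgrp_eq mem_Collect_eq rangeI simp_thms)

end


section \<open>The conjugacy search problem as a discrete logarithm problem\<close>

theorem mainTheorem4:
  fixes k :: nat and m :: "nat \<Rightarrow> nat"
  assumes k_pos: "1 \<le> k"
    and m_pos: "\<forall>l\<in>{1..k}. 0 < m l"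
    and free_rank_k:
      "subgroup_generated (mult_of rat_ring) ((\<lambda>l. of_nat (m l)) ` {1..k})
         \<cong> free_Abelian_group {1..k}"
    and coprime_m: "\<forall>l\<in>{1..k}. coprime (int (m l)) (1 - int (m 1))"
  shows
    "Bbar k m = Bring k m Quot (PIdl\<^bsub>Bring k m\<^esub> (1 - of_nat (m 1)))
     \<and> Bbar k m \<simeq> ZFact (1 - int (m 1))
     \<and> (\<forall>l\<in>{1..k}. ZMod (1 - int (m 1)) (int (m l)) \<in> Units (ZFact (1 - int (m 1))))
     \<and> (\<exists>\<beta>. semidirect_identification k m \<beta> \<and>
         (\<forall>\<psi>\<in>ring_iso (Bbar k m) (ZFact (1 - int (m 1))).
          \<forall>b\<in>carrier (Bring k m). \<forall>b1\<in>carrier (Bring k m).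
           (\<exists>g\<in>carrier (G k m). conjugates (G k m) g
               (\<beta> b \<otimes>\<^bsub>G k m\<^esub> q k m 1) (\<beta> b1 \<otimes>\<^bsub>G k m\<^esub> q k m 1)) \<longrightarrow>
           (let Z = ZFact (1 - int (m 1));
                mbar = (\<lambda>l. ZMod (1 - int (m 1)) (int (m l)));
                solves = (\<lambda>t :: nat \<Rightarrow> int.
                  (\<Otimes>\<^bsub>Z\<^esub>l\<in>{2..k}. mbar l [^]\<^bsub>Z\<^esub> t l) \<otimes>\<^bsub>Z\<^esub> \<psi> (bar k m b) = \<psi> (bar k m b1));
                Y = conjugator_Q_components k m \<beta> b b1
            in (\<forall>t. qpow k m t \<in> Y \<longleftrightarrow> solves t)
               \<and> Y = {qpow k m t | t. solves t}
               \<and> (k = 2 \<longrightarrow>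
                    (\<forall>(t1::int) (t2::int).
                       (q k m 1 [^]\<^bsub>G k m\<^esub> t1) \<otimes>\<^bsub>G k m\<^esub> (q k m 2 [^]\<^bsub>G k m\<^esub> t2) \<in> Y
                       \<longleftrightarrow> is_dlog Z (mbar 2) (\<psi> (bar k m b)) (\<psi> (bar k m b1)) t2)
                    \<and> Y = {(q k m 1 [^]\<^bsub>G k m\<^esub> t1) \<otimes>\<^bsub>G k m\<^esub> (q k m 2 [^]\<^bsub>G k m\<^esub> t2) | (t1::int) (t2::int).
                            is_dlog Z (mbar 2) (\<psi> (bar k m b)) (\<psi> (bar k m b1)) t2}))))"
proof -
  interpret coprime_multipliers k m
    using k_pos m_pos coprime_m by unfold_locales
  have main: "let Z = ZFact (1 - int (m 1));
                mbar = (\<lambda>l. ZMod (1 - int (m 1)) (int (m l)));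
                solves = (\<lambda>t :: nat \<Rightarrow> int.
                  (\<Otimes>\<^bsub>Z\<^esub>l\<in>{2..k}. mbar l [^]\<^bsub>Z\<^esub> t l) \<otimes>\<^bsub>Z\<^esub> \<psi> (bar k m b) = \<psi> (bar k m b1));
                Y = conjugator_Q_components k m rat_power b b1
            in (\<forall>t. qpow k m t \<in> Y \<longleftrightarrow> solves t)
               \<and> Y = {qpow k m t | t. solves t}
               \<and> (k = 2 \<longrightarrow>
                    (\<forall>(t1::int) (t2::int).
                       (q k m 1 [^]\<^bsub>G k m\<^esub> t1) \<otimes>\<^bsub>G k m\<^esub> (q k m 2 [^]\<^bsub>G k m\<^esub> t2) \<in> Y
                       \<longleftrightarrow> is_dlog Z (mbar 2) (\<psi> (bar k m b)) (\<psi> (bar k m b1)) t2)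
                    \<and> Y = {(q k m 1 [^]\<^bsub>G k m\<^esub> t1) \<otimes>\<^bsub>G k m\<^esub> (q k m 2 [^]\<^bsub>G k m\<^esub> t2) | (t1::int) (t2::int).
                            is_dlog Z (mbar 2) (\<psi> (bar k m b)) (\<psi> (bar k m b1)) t2})"
    if \<psi>: "\<psi> \<in> ring_iso (Bbar k m) Z"
      and b: "b \<in> carrier (Bring k m)" and b1: "b1 \<in> carrier (Bring k m)" for \<psi> b b1
  proof -
    define Y where "Y = conjugator_Q_components k m rat_power b b1"
    define solves where "solves t \<longleftrightarrow>
      (\<Otimes>\<^bsub>Z\<^esub>l\<in>{2..k}. mbar l [^]\<^bsub>Z\<^esub> t l) \<otimes>\<^bsub>Z\<^esub> \<psi> (bar k m b) = \<psi> (bar k m b1)" for t :: "nat \<Rightarrow> int"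
    have Y_iff: "qpow k m t \<in> Y \<longleftrightarrow> solves t" for t
      unfolding Y_def solves_def
      using qpow_mem_conjugator_Q_components_iff[OF \<psi>] b b1 by (simp only: carrier_Bring)
    have "Y \<subseteq> range (qpow k m)"
      by (auto simp: Y_def conjugator_Q_components_def Qgrp_eq)
    then have Y: "Y = {qpow k m t | t. solves t}" using Y_iff by blast
    have two: "(\<forall>(t1::int) (t2::int).
                   (q k m 1 [^]\<^bsub>G k m\<^esub> t1) \<bullet> (q k m 2 [^]\<^bsub>G k m\<^esub> t2) \<in> Y
                   \<longleftrightarrow> is_dlog Z (mbar 2) (\<psi> (bar k m b)) (\<psi> (bar k m b1)) t2)
               \<and> Y = {(q k m 1 [^]\<^bsub>G k m\<^esub> t1) \<bullet> (q k m 2 [^]\<^bsub>G k m\<^esub> t2) | (t1::int) (t2::int).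
                        is_dlog Z (mbar 2) (\<psi> (bar k m b)) (\<psi> (bar k m b1)) t2}"
      if k2: "k = 2"
    proof -
      have qs: "q k m 1 \<in> carrier (G k m)" "q k m 2 \<in> carrier (G k m)"
        using q_closed[of 1] q_closed[of 2] k2 by simp_all
      have qpow2: "qpow k m t = (q k m 1 [^]\<^bsub>G k m\<^esub> t 1) \<bullet> (q k m 2 [^]\<^bsub>G k m\<^esub> t 2)" for t
      proof -
        have "[1..<Suc k] = [1, 2]" using k2 by (simp add: upt_rec)
        then show ?thesis using qs by (simp add: qpow_power_product del: One_nat_def)
      qed
      have solves2: "solves t \<longleftrightarrow> is_dlog Z (mbar 2) (\<psi> (bar k m b)) (\<psi> (bar k m b1)) (t 2)" for t
      proof -
        have "mbar 2 [^]\<^bsub>Z\<^esub> t 2 \<in> carrier Z"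
          using Bring_hom.\<phi>_m_powi_closed[OF residue_hom(1)[OF \<psi>], of 2 "t 2"] k2
          unfolding residue_hom(2)[OF \<psi>] by simp
        then have "(\<Otimes>\<^bsub>Z\<^esub>l\<in>{2}. mbar l [^]\<^bsub>Z\<^esub> t l) = mbar 2 [^]\<^bsub>Z\<^esub> t 2"
          by (rule comm_monoid.finprod_single[OF cring.axioms(2)[OF ZFact_is_cring]])
        moreover have "{2..k} = {2}" using k2 by simp
        ultimately show ?thesis by (simp only: solves_def is_dlog_def)
      qed
      have "(q k m 1 [^]\<^bsub>G k m\<^esub> t1) \<bullet> (q k m 2 [^]\<^bsub>G k m\<^esub> t2) \<in> Y
          \<longleftrightarrow> is_dlog Z (mbar 2) (\<psi> (bar k m b)) (\<psi> (bar k m b1)) t2" for t1 t2 :: int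
        using Y_iff[of "\<lambda>l. if l = 1 then t1 else t2"]
        unfolding qpow2 solves2 by simp
      moreover have "\<exists>(t1::int) (t2::int). y = (q k m 1 [^]\<^bsub>G k m\<^esub> t1) \<bullet> (q k m 2 [^]\<^bsub>G k m\<^esub> t2)"
        if y: "y \<in> Y" for y
      proof -
        obtain t where "y = qpow k m t" using y \<open>Y \<subseteq> range (qpow k m)\<close> by blast
        then show ?thesis unfolding qpow2 by (intro exI)
      qed
      ultimately show ?thesis by blast
    qed
    show ?thesis
      unfolding Let_def Y_def[symmetric] solves_def[symmetric] using Y_iff Y two by blast
  qed
  show ?thesis
  proof (intro conjI exI[of _ rat_power] ballI impI)
    show "Bbar k m = Bring k m Quot (PIdl\<^bsub>Bring k m\<^esub> (1 - of_nat (m 1)))"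
      by (simp only: Bbar_def I_cgenideal)
  qed (rule Bbar_iso_ZFact mbar_Units[rule_format] rat_power_semidirect_identification main;
      assumption)+
qed

end
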